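(* Let $L$ be a torsion-free Lie algebra over $\mathbb{C}[\![t]\!]$, finitely generated as a $\mathbb{C}[\![t]\!]$-module, with $\mathbb{C}[\![t]\!]$-basis $\{x_1,\ldots,x_d\}$, and let $*\in\{\le,\triangleleft\}$. Suppose $C$ is a set of removable pairs $(i,j)$ (with $1\le i<j\le d$). Then $$R_L^*(T)=\sum_{\mathbf{n}\in\mathbb{Z}_{\ge 0}^{d}} \chi(\mathcal{E}_{\mathbf{n},C}\cap\mathcal{F}_{\mathbf{n}}^* )\, T^{n_1+\cdots+n_d}.$$
   Context: Reduced zeta function: let $\chi$ be the Euler characteristic on constructible sets over $\mathbb{C}$ (the unique integer-valued function with $\chi(\mathbb{C}^m)=1$, additive on disjoint constructible sets, and with $\chi(B)=e\chi(A)$ whenever $f:B\to A$ is a constructible map all of whose fibres have Euler characteristic $e$). For $n\ge0$ let $B_n^{\le}$ (resp. $B_n^{\triangleleft}$) be the constructible subset of the Grassmannian $\mathrm{Gr}(L/t^nL)$ consisting of the $\mathbb{C}[\![t]\!]$-submodules of $L$ of $\mathbb{C}$-codimension $n$ that are subalgebras (resp. ideals); then $R_L^*(T)=\sum_{n\ge0}\chi(B_n^* )T^n$ (this equals $\chi$ applied coefficientwise to the motivic zeta function $\sum_n [B_n^*]T^n$). Write elements of $L$ as row vectors of coordinates in the basis $\{x_1,\dots,x_d\}$. For $\mathbf{n}=(n_1,\ldots,n_d)\in\mathbb{Z}_{\ge0}^d$, let $\mathcal{T}_{\mathbf{n}}$ be the set of upper triangular $d\times d$ matrices with diagonal entries $t^{n_1},\ldots,t^{n_d}$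 and entries $a_{ij}$ ($i<j$) which are polynomials in $t$ with complex coefficients of degree $<n_j$; writing $a_{ij}=\sum_{l=0}^{n_j-1}a_{ij}^{(l)}t^l$, $\mathcal{T}_{\mathbf{n}}$ is identified with complex affine space in the coordinates $a_{ij}^{(l)}$. For $M\in\mathcal{T}_{\mathbf{n}}$, $\Xi(M)$ is the $\mathbb{C}[\![t]\!]$-submodule of $L$ spanned by its rows. $\mathcal{F}^{\le}_{\mathbf{n}}$ (resp. $\mathcal{F}^{\triangleleft}_{\mathbf{n}}$) is the constructible subset of $\mathcal{T}_{\mathbf{n}}$ of those $M$ with $\Xi(M)$ a subalgebra (resp. ideal) of $L$. For a set $C$ of pairs, $\mathcal{E}_{\mathbf{n},C}$ is the subvariety of $\mathcal{T}_{\mathbf{n}}$ where $a_{ij}=0$ for all $(i,j)\in C$. A pair $(i,j)$, $1\le i<j\le d$, is removable if there exist integers $l_1,\ldots,l_d$ with $l_i\ne l_j$ such that for every $z\in\mathbb{C}^*$ the $\mathbb{C}[\![t]\!]$-linear map $x_r\mapsto z^{l_r}x_r$ ($r=1,\ldots,d$) is an automorphism of $L$. *)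

theory Defs
  imports "HOL-Computational_Algebra.Formal_Power_Series"
begin

definition aff :: "nat \<Rightarrow> (nat \<Rightarrow> complex) set" where
  "aff N = {x. \<forall>i\<ge>N. x i = 0}"

inductive_set polyfun :: "((nat \<Rightarrow> complex) \<Rightarrow> complex) set" where
  pconst: "(\<lambda>x. a) \<in> polyfun"
| pvar: "(\<lambda>x. x i) \<in> polyfun"
| padd: "p \<in> polyfun \<Longrightarrow> q \<in> polyfun \<Longrightarrow> (\<lambda>x. p x + q x) \<in> polyfun"
| pmult: "p \<in> polyfun \<Longrightarrow> q \<in> polyfun \<Longrightarrow> (\<lambda>x. p x * q x) \<in> polyfun"

definition zariski_closed :: "nat \<Rightarrow> (nat \<Rightarrow> complex) set \<Rightarrow> bool" where
  "zariski_closed N A \<longleftrightarrow>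
     (\<exists>P. finite P \<and> P \<subseteq> polyfun \<and> A = {x \<in> aff N. \<forall>p\<in>P. p x = 0})"

inductive_set constr :: "nat \<Rightarrow> (nat \<Rightarrow> complex) set set" for N where
  cclosed: "zariski_closed N A \<Longrightarrow> A \<in> constr N"
| ccompl: "A \<in> constr N \<Longrightarrow> aff N - A \<in> constr N"
| cunion: "A \<in> constr N \<Longrightarrow> B \<in> constr N \<Longrightarrow> A \<union> B \<in> constr N"

definition constructible :: "(nat \<Rightarrow> complex) set \<Rightarrow> bool" where
  "constructible A \<longleftrightarrow> (\<exists>N. A \<in> constr N)"

definition join :: "nat \<Rightarrow> (nat \<Rightarrow> complex) \<Rightarrow> (nat \<Rightarrow> complex) \<Rightarrow> (nat \<Rightarrow> complex)" where
  "join N x y = (\<lambda>i. if i < N then x i else y (i - N))"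

definition constr_map :: "(nat \<Rightarrow> complex) set \<Rightarrow> ((nat \<Rightarrow> complex) \<Rightarrow> (nat \<Rightarrow> complex)) \<Rightarrow> bool" where
  "constr_map B f \<longleftrightarrow> (\<exists>N M. B \<subseteq> aff N \<and> f ` B \<subseteq> aff M \<and>
      constructible {join N x (f x) | x. x \<in> B})"

definition euler_char :: "((nat \<Rightarrow> complex) set \<Rightarrow> int) \<Rightarrow> bool" where
  "euler_char chi \<longleftrightarrow>
     (\<forall>m. chi (aff m) = 1) \<and>
     (\<forall>A B. constructible A \<and> constructible B \<and> A \<inter> B = {} \<longrightarrow> chi (A \<union> B) = chi A + chi B) \<and>
     (\<forall>A B f e. constructible A \<and> constructible B \<and> constr_map B f \<and> f ` B \<subseteq> A \<and>
        (\<forall>a\<in>A. chi {x \<in> B. f x = a} = e) \<longrightarrow> chi B = e * chi A)"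

definition rref :: "nat \<Rightarrow> nat \<Rightarrow> (nat \<Rightarrow> nat \<Rightarrow> complex) \<Rightarrow> bool" where
  "rref N k R \<longleftrightarrow>
     (\<exists>p :: nat \<Rightarrow> nat. strict_mono_on {..<k} p \<and>
        (\<forall>r<k. p r < N \<and> R r (p r) = 1 \<and> (\<forall>c<p r. R r c = 0) \<and>
                (\<forall>r'<k. r' \<noteq> r \<longrightarrow> R r' (p r) = 0))) \<and>
     (\<forall>r c. k \<le> r \<or> N \<le> c \<longrightarrow> R r c = 0)"

definition rowspace :: "nat \<Rightarrow> (nat \<Rightarrow> nat \<Rightarrow> complex) \<Rightarrow> (nat \<Rightarrow> complex) set" where
  "rowspace k R = {(\<lambda>c. \<Sum>r<k. a r * R r c) | a. True}"

definition flat :: "nat \<Rightarrow> nat \<Rightarrow> (nat \<Rightarrow> nat \<Rightarrow> complex) \<Rightarrow> (nat \<Rightarrow> complex)" where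
  "flat N k R = (\<lambda>i. if i < k * N then R (i div N) (i mod N) else 0)"

text \<open>A set S of subspaces of C^N of codimension m, as a subset of affine space
  (each subspace represented by the unique RREF matrix whose rows span it).\<close>
definition grass_pts :: "nat \<Rightarrow> nat \<Rightarrow> (nat \<Rightarrow> complex) set set \<Rightarrow> (nat \<Rightarrow> complex) set" where
  "grass_pts N m S = {flat N (N - m) R | R. m \<le> N \<and> rref N (N - m) R \<and> rowspace (N - m) R \<in> S}"

type_synonym vec = "nat \<Rightarrow> complex fps"

definition Lset :: "nat \<Rightarrow> vec set" where
  "Lset d = {u. \<forall>i\<ge>d. u i = 0}"

definition vadd :: "vec \<Rightarrow> vec \<Rightarrow> vec" where
  "vadd u v = (\<lambda>i. u i + v i)"

definition smul :: "complex fps \<Rightarrow> vec \<Rightarrow> vec" where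
  "smul a u = (\<lambda>i. a * u i)"

text \<open>Bracket from structure constants: [x_i, x_j] = sum_k c i j k x_k.\<close>
definition lbr :: "nat \<Rightarrow> (nat \<Rightarrow> nat \<Rightarrow> nat \<Rightarrow> complex fps) \<Rightarrow> vec \<Rightarrow> vec \<Rightarrow> vec" where
  "lbr d c u v = (\<lambda>k. if k < d then \<Sum>i<d. \<Sum>j<d. u i * v j * c i j k else 0)"

definition lie_algebra :: "nat \<Rightarrow> (nat \<Rightarrow> nat \<Rightarrow> nat \<Rightarrow> complex fps) \<Rightarrow> bool" where
  "lie_algebra d c \<longleftrightarrow>
     (\<forall>u\<in>Lset d. lbr d c u u = (\<lambda>_. 0)) \<and>
     (\<forall>u\<in>Lset d. \<forall>v\<in>Lset d. \<forall>w\<in>Lset d.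
        vadd (lbr d c u (lbr d c v w)) (vadd (lbr d c v (lbr d c w u)) (lbr d c w (lbr d c u v)))
          = (\<lambda>_. 0))"

definition lie_aut :: "nat \<Rightarrow> (nat \<Rightarrow> nat \<Rightarrow> nat \<Rightarrow> complex fps) \<Rightarrow> (vec \<Rightarrow> vec) \<Rightarrow> bool" where
  "lie_aut d c \<phi> \<longleftrightarrow> bij_betw \<phi> (Lset d) (Lset d) \<and>
     (\<forall>u\<in>Lset d. \<forall>v\<in>Lset d. \<phi> (vadd u v) = vadd (\<phi> u) (\<phi> v)) \<and>
     (\<forall>a. \<forall>u\<in>Lset d. \<phi> (smul a u) = smul a (\<phi> u)) \<and>
     (\<forall>u\<in>Lset d. \<forall>v\<in>Lset d. \<phi> (lbr d c u v) = lbr d c (\<phi> u) (\<phi> v))"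

definition removable :: "nat \<Rightarrow> (nat \<Rightarrow> nat \<Rightarrow> nat \<Rightarrow> complex fps) \<Rightarrow> nat \<times> nat \<Rightarrow> bool" where
  "removable d c p \<longleftrightarrow> (case p of (i, j) \<Rightarrow> i < j \<and> j < d \<and>
     (\<exists>l :: nat \<Rightarrow> int. l i \<noteq> l j \<and>
        (\<forall>z :: complex. z \<noteq> 0 \<longrightarrow>
           lie_aut d c (\<lambda>u r. fps_const (z powi l r) * u r))))"

datatype subkind = Subalg | Ideal

definition is_submod :: "nat \<Rightarrow> vec set \<Rightarrow> bool" where
  "is_submod d M \<longleftrightarrow> M \<subseteq> Lset d \<and> (\<lambda>_. 0) \<in> M \<and>
     (\<forall>u\<in>M. \<forall>v\<in>M. vadd u v \<in> M) \<and> (\<forall>a. \<forall>u\<in>M. smul a u \<in> M)"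

definition good :: "nat \<Rightarrow> (nat \<Rightarrow> nat \<Rightarrow> nat \<Rightarrow> complex fps) \<Rightarrow> subkind \<Rightarrow> vec set \<Rightarrow> bool" where
  "good d c kind M \<longleftrightarrow> is_submod d M \<and>
     (case kind of
        Subalg \<Rightarrow> (\<forall>u\<in>M. \<forall>v\<in>M. lbr d c u v \<in> M)
      | Ideal \<Rightarrow> (\<forall>u\<in>Lset d. \<forall>v\<in>M. lbr d c u v \<in> M))"

text \<open>L/t^nL identified with C^(d n): coordinate i*n+l is the coefficient of t^l in coordinate i.\<close>
definition trunc :: "nat \<Rightarrow> nat \<Rightarrow> vec \<Rightarrow> (nat \<Rightarrow> complex)" where
  "trunc d n u = (\<lambda>q. if q < d * n then fps_nth (u (q div n)) (q mod n) else 0)"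

definition preim :: "nat \<Rightarrow> nat \<Rightarrow> (nat \<Rightarrow> complex) set \<Rightarrow> vec set" where
  "preim d n W = {u \<in> Lset d. trunc d n u \<in> W}"

definition Bset :: "nat \<Rightarrow> (nat \<Rightarrow> nat \<Rightarrow> nat \<Rightarrow> complex fps) \<Rightarrow> subkind \<Rightarrow> nat \<Rightarrow> (nat \<Rightarrow> complex) set" where
  "Bset d c kind n = grass_pts (d * n) n {W. good d c kind (preim d n W)}"

definition zeta :: "((nat \<Rightarrow> complex) set \<Rightarrow> int) \<Rightarrow> nat \<Rightarrow> (nat \<Rightarrow> nat \<Rightarrow> nat \<Rightarrow> complex fps) \<Rightarrow> subkind \<Rightarrow> int fps" where
  "zeta chi d c kind = Abs_fps (\<lambda>n. chi (Bset d c kind n))"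

definition comps :: "nat \<Rightarrow> nat \<Rightarrow> (nat \<Rightarrow> nat) set" where
  "comps d N = {n. (\<forall>i\<ge>d. n i = 0) \<and> (\<Sum>i<d. n i) = N}"

definition tcoord :: "nat \<Rightarrow> (nat \<Rightarrow> nat) \<Rightarrow> nat \<Rightarrow> nat \<Rightarrow> nat \<Rightarrow> nat" where
  "tcoord d n i j l = (i * d + j) * (\<Sum>r<d. n r) + l"

definition tvalid :: "nat \<Rightarrow> (nat \<Rightarrow> nat) \<Rightarrow> nat set" where
  "tvalid d n = {tcoord d n i j l | i j l. i < j \<and> j < d \<and> l < n j}"

definition Tset :: "nat \<Rightarrow> (nat \<Rightarrow> nat) \<Rightarrow> (nat \<Rightarrow> complex) set" where
  "Tset d n = {x. \<forall>q. q \<notin> tvalid d n \<longrightarrow> x q = 0}"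

definition tmat :: "nat \<Rightarrow> (nat \<Rightarrow> nat) \<Rightarrow> (nat \<Rightarrow> complex) \<Rightarrow> nat \<Rightarrow> nat \<Rightarrow> complex fps" where
  "tmat d n x i j = (if i < d \<and> j < d then
       (if i = j then fps_X ^ (n i)
        else if i < j then Abs_fps (\<lambda>l. if l < n j then x (tcoord d n i j l) else 0)
        else 0)
     else 0)"

definition Xi :: "nat \<Rightarrow> (nat \<Rightarrow> nat \<Rightarrow> complex fps) \<Rightarrow> vec set" where
  "Xi d M = {(\<lambda>k. \<Sum>i<d. a i * M i k) | a. True}"

definition Fset :: "nat \<Rightarrow> (nat \<Rightarrow> nat \<Rightarrow> nat \<Rightarrow> complex fps) \<Rightarrow> subkind \<Rightarrow> (nat \<Rightarrow> nat) \<Rightarrow> (nat \<Rightarrow> complex) set" where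
  "Fset d c kind n = {x \<in> Tset d n. good d c kind (Xi d (tmat d n x))}"

definition Eset :: "nat \<Rightarrow> (nat \<Rightarrow> nat) \<Rightarrow> (nat \<times> nat) set \<Rightarrow> (nat \<Rightarrow> complex) set" where
  "Eset d n C = {x \<in> Tset d n. \<forall>(i, j)\<in>C. tmat d n x i j = 0}"

end

theory Submission
  imports Defs
begin

text \<open>
  A submodule of \<open>L\<close> containing \<open>t\<^sup>N L\<close> has a unique Hermite normal form, so the space of
  submodules of codimension \<open>N\<close> is stratified by the diagonal exponents \<open>n\<close>. The map sending a
  normal form to the reduced row echelon matrix of the submodule modulo \<open>t\<^sup>N\<close> is polynomial, and
  it is inverted by reading off coordinates. Hence each stratum is constructible and has the
  Euler characteristic of the parameter set \<open>F\<^sub>n\<close>.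

  The diagonal automorphisms attached to a removable pair \<open>(i, j)\<close> multiply every coefficient of
  \<open>a\<^sub>i\<^sub>j\<close> by a nonconstant character of the torus and preserve both \<open>F\<^sub>n\<close> and all coordinate
  subspaces. The part where such a coefficient is nonzero fibres over the punctured line
  with fibres of constant Euler characteristic, so it contributes zero; the coefficients of all
  removable pairs can therefore be set to zero one after the other.
\<close>

section \<open>Polynomial maps and constructible sets\<close>

text \<open>The axioms for \<open>chi\<close> speak only of constructible maps whose fibres have
  constant characteristic; that a point has characteristic 1 and that bijections preserve
  \<open>chi\<close> must be derived. Every application needs some graph, fibre or image to be
  constructible. To avoid projecting constructible sets, all maps are polynomial, which makes
  graphs, preimages and fibres visibly constructible, and the images of the parameter sets are
  described through an explicit polynomial left inverse. Two facts make the parametrisation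
  polynomial. The diagonal of a normal form consists of powers of t, so division by it is a shift of
  coefficients. And t^N kills the quotient of L by a submodule whose exponents sum to N, so
  truncation at level N loses nothing and one Grassmannian holds all strata of codimension
  N.\<close>

definition poly_map :: "((nat \<Rightarrow> complex) \<Rightarrow> (nat \<Rightarrow> complex)) \<Rightarrow> bool" where
  "poly_map g \<longleftrightarrow> (\<forall>i. (\<lambda>x. g x i) \<in> polyfun)"

lemma polyfun_uminus: "p \<in> polyfun \<Longrightarrow> (\<lambda>x. - p x) \<in> polyfun"
  using polyfun.pmult[OF polyfun.pconst[of "-1"], of p] by simp

lemma polyfun_diff: "p \<in> polyfun \<Longrightarrow> q \<in> polyfun \<Longrightarrow> (\<lambda>x. p x - q x) \<in> polyfun"
  using polyfun.padd[of p "\<lambda>x. - q x"] polyfun_uminus[of q] by simp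

lemma polyfun_sum:
  assumes "\<And>i. i \<in> I \<Longrightarrow> p i \<in> polyfun"
  shows "(\<lambda>x. \<Sum>i\<in>I. p i x) \<in> polyfun"
proof (cases "finite I")
  case True
  then show ?thesis
    using assms by (induction I rule: finite_induct) (auto intro: polyfun.intros)
qed (auto intro: polyfun.intros)

lemma polyfun_comp:
  assumes "p \<in> polyfun" "poly_map g"
  shows "(\<lambda>x. p (g x)) \<in> polyfun"
  using assms by (induction) (auto simp: poly_map_def intro: polyfun.intros)

lemma poly_mapI: "(\<And>i. (\<lambda>x. g x i) \<in> polyfun) \<Longrightarrow> poly_map g"
  by (simp add: poly_map_def)

lemma poly_map_component: "poly_map g \<Longrightarrow> (\<lambda>x. g x i) \<in> polyfun"
  by (simp add: poly_map_def)

lemma poly_map_cases: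
  assumes "\<And>i. P i \<Longrightarrow> (\<lambda>x. g x i) \<in> polyfun"
  shows "poly_map (\<lambda>x i. if P i then g x i else 0)"
proof (rule poly_mapI)
  fix i show "(\<lambda>x. if P i then g x i else 0) \<in> polyfun"
    using assms polyfun.pconst by (cases "P i") auto
qed

lemma zariski_closed_eqs:
  assumes "finite I" "\<And>i. i \<in> I \<Longrightarrow> p i \<in> polyfun"
  shows "zariski_closed N {x \<in> aff N. \<forall>i\<in>I. p i x = 0}"
  unfolding zariski_closed_def using assms by (intro exI[of _ "p ` I"]) auto

lemma constr_eqs:
  assumes "finite I" "\<And>i. i \<in> I \<Longrightarrow> p i \<in> polyfun"
  shows "{x \<in> aff N. \<forall>i\<in>I. p i x = 0} \<in> constr N"
  by (rule constr.cclosed[OF zariski_closed_eqs[OF assms]])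

lemma constr_aff: "aff N \<in> constr N"
  using constr_eqs[of "{}"] by simp

lemma constr_empty: "{} \<in> constr N"
  using constr.ccompl[OF constr_aff] by simp

lemma constr_subset_aff: "A \<in> constr N \<Longrightarrow> A \<subseteq> aff N"
  by (induction rule: constr.induct) (auto simp: zariski_closed_def)

lemma constr_Int:
  assumes "A \<in> constr N" "B \<in> constr N"
  shows "A \<inter> B \<in> constr N"
proof -
  have "A \<inter> B = aff N - ((aff N - A) \<union> (aff N - B))"
    using assms constr_subset_aff by blast
  then show ?thesis using assms by (metis constr.ccompl constr.cunion)
qed

lemma constr_Diff:
  assumes "A \<in> constr N" "B \<in> constr N"
  shows "A - B \<in> constr N"
proof -
  have "A - B = A \<inter> (aff N - B)"
    using assms constr_subset_aff by blast
  then show ?thesis using assms by (metis constr.ccompl constr_Int)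
qed

lemma constr_UN:
  assumes "finite I" "\<And>i. i \<in> I \<Longrightarrow> A i \<in> constr N"
  shows "(\<Union>i\<in>I. A i) \<in> constr N"
  using assms by (induction I rule: finite_induct) (auto intro: constr_empty constr.cunion)

lemma constr_restrict_eqs:
  assumes "A \<in> constr N" "finite I" "\<And>i. i \<in> I \<Longrightarrow> p i \<in> polyfun"
  shows "{x \<in> A. \<forall>i\<in>I. p i x = 0} \<in> constr N"
proof -
  have "{x \<in> A. \<forall>i\<in>I. p i x = 0} = A \<inter> {x \<in> aff N. \<forall>i\<in>I. p i x = 0}"
    using assms constr_subset_aff by blast
  then show ?thesis using constr_Int[OF assms(1) constr_eqs[of I p N]] assms(2,3) by simp
qed

lemma constr_restrict_eq:
  assumes "A \<in> constr N" "p \<in> polyfun"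
  shows "{x \<in> A. p x = 0} \<in> constr N"
  using constr_restrict_eqs[of A N "{()}" "\<lambda>_. p"] assms by simp

lemma constr_preimage:
  assumes "A \<in> constr N" "poly_map g" "\<And>y. y \<in> aff K \<Longrightarrow> g y \<in> aff N"
  shows "{y \<in> aff K. g y \<in> A} \<in> constr K"
  using assms(1)
proof (induction rule: constr.induct)
  case (cclosed A)
  then obtain P where P: "finite P" "P \<subseteq> polyfun" "A = {x \<in> aff N. \<forall>p\<in>P. p x = 0}"
    unfolding zariski_closed_def by blast
  have "{y \<in> aff K. g y \<in> A} = {y \<in> aff K. \<forall>p\<in>P. p (g y) = 0}"
    using P assms(3) by auto
  moreover have "{y \<in> aff K. \<forall>p\<in>P. p (g y) = 0} \<in> constr K"
    using P constr_eqs[of P "\<lambda>p y. p (g y)" K, OF _ polyfun_comp[OF _ assms(2)]] by blast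
  ultimately show ?case by simp
next
  case (ccompl A)
  have "{y \<in> aff K. g y \<in> aff N - A} = aff K - {y \<in> aff K. g y \<in> A}"
    using assms(3) by blast
  then show ?case using constr.ccompl[OF ccompl.IH] by simp
next
  case (cunion A B)
  have "{y \<in> aff K. g y \<in> A \<union> B} = {y \<in> aff K. g y \<in> A} \<union> {y \<in> aff K. g y \<in> B}" by auto
  then show ?case using constr.cunion[OF cunion.IH] by simp
qed

text \<open>Inside the cylinder over \<open>B\<close> the graph is cut out by \<open>M\<close>
  polynomial equations expressing the last coordinates through the first \<open>N\<close>;
  \<open>cut\<close> is the projection to the latter.\<close>

lemma constr_map_poly:
  assumes B: "B \<in> constr N" and g: "poly_map g" and gB: "g ` B \<subseteq> aff M"
  shows "constr_map B g"
proof -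
  define cut :: "(nat \<Rightarrow> complex) \<Rightarrow> nat \<Rightarrow> complex" where "cut y i = (if i < N then y i else 0)" for y i
  have cut: "poly_map cut"
    unfolding cut_def [abs_def] by (rule poly_map_cases) (rule polyfun.pvar)
  have BN: "B \<subseteq> aff N" using B by (rule constr_subset_aff)
  have eq: "{join N x (g x) | x. x \<in> B} =
     {y \<in> {y \<in> aff (N + M). cut y \<in> B}. \<forall>i\<in>{..<M}. y (N + i) - g (cut y) i = 0}" (is "?L = ?R")
  proof (intro equalityI subsetI)
    fix y assume "y \<in> ?L"
    then obtain x where x: "x \<in> B" "y = join N x (g x)" by blast
    have "cut y = x" using x BN by (auto simp: cut_def join_def aff_def fun_eq_iff)
    moreover have "y \<in> aff (N + M)" using x gB by (auto simp: aff_def join_def)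
    ultimately show "y \<in> ?R" using x by (auto simp: join_def)
  next
    fix y assume y: "y \<in> ?R"
    have "y i = join N (cut y) (g (cut y)) i" for i
    proof (cases "i < N")
      case False
      show ?thesis
      proof (cases "i < N + M")
        case True
        then show ?thesis using False y by (auto simp: join_def dest!: bspec[of _ _ "i - N"])
      next
        case F: False
        have "g (cut y) \<in> aff M" using y gB by auto
        then show ?thesis using y F False by (auto simp: join_def aff_def)
      qed
    qed (auto simp: join_def cut_def)
    then have "y = join N (cut y) (g (cut y))" by blast
    then show "y \<in> ?L" using y by blast
  qed
  have "?R \<in> constr (N + M)"
  proof (intro constr_restrict_eqs constr_preimage[OF B cut] polyfun_diff polyfun.pvar)
    show "(\<lambda>x. g (cut x) i) \<in> polyfun" for i
      using polyfun_comp[OF poly_map_component[OF g] cut] .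
  qed (auto simp: aff_def cut_def)
  then have "constructible {join N x (g x) | x. x \<in> B}"
    unfolding constructible_def eq by (rule exI)
  then show ?thesis
    unfolding constr_map_def using BN gB by blast
qed

section \<open>Consequences of the axioms for the Euler characteristic\<close>

lemma constr_constructible: "A \<in> constr N \<Longrightarrow> constructible A"
  unfolding constructible_def by blast

lemma euler_char_Un:
  assumes "euler_char chi" "constructible A" "constructible B" "A \<inter> B = {}"
  shows "chi (A \<union> B) = chi A + chi B"
  using assms unfolding euler_char_def by blast

lemma euler_char_empty:
  assumes "euler_char chi"
  shows "chi {} = 0"
  using euler_char_Un[OF assms constr_constructible[OF constr_empty[of 0]] constr_constructible[OF constr_empty[of 0]]]
  by simp

lemma euler_char_UN:
  assumes "euler_char chi" "finite I" "\<And>i. i \<in> I \<Longrightarrow> A i \<in> constr N"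
    "\<And>i j. i \<in> I \<Longrightarrow> j \<in> I \<Longrightarrow> i \<noteq> j \<Longrightarrow> A i \<inter> A j = {}"
  shows "chi (\<Union>i\<in>I. A i) = (\<Sum>i\<in>I. chi (A i))"
  using assms(2-)
proof (induction I rule: finite_induct)
  case empty
  then show ?case using euler_char_empty[OF assms(1)] by simp
next
  case (insert i I)
  have "A i \<inter> (\<Union>i\<in>I. A i) = {}" using insert.hyps insert.prems(2) by (auto simp: set_eq_iff)
  moreover have "(\<Union>i\<in>I. A i) \<in> constr N" 
    by (rule constr_UN) (use insert in auto)
  ultimately have "chi (A i \<union> (\<Union>i\<in>I. A i)) = chi (A i) + chi (\<Union>i\<in>I. A i)"
    using insert.prems by (intro euler_char_Un[OF assms(1)] constr_constructible) auto
  then show ?case using insert by auto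
qed

lemma euler_char_fibration:
  assumes "euler_char chi" "A \<in> constr M" "B \<in> constr N" "poly_map f" "f ` B \<subseteq> A"
    "\<And>a. a \<in> A \<Longrightarrow> chi {x \<in> B. f x = a} = e"
  shows "chi B = e * chi A"
proof -
  have f: "constr_map B f"
    using constr_map_poly[OF assms(3,4)] assms(5) constr_subset_aff[OF assms(2)] by blast
  have "\<forall>A B f e. constructible A \<and> constructible B \<and> constr_map B f \<and> f ` B \<subseteq> A \<and>
        (\<forall>a\<in>A. chi {x \<in> B. f x = a} = e) \<longrightarrow> chi B = e * chi A"
    using assms(1) unfolding euler_char_def by blast
  from this[rule_format, of A B f e] show ?thesis
    using f assms(5,6) constr_constructible[OF assms(2)] constr_constructible[OF assms(3)] by blast
qed

lemma aff_0: "aff 0 = {\<lambda>_. 0}"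
  by (auto simp: aff_def)

lemma constr_singleton:
  assumes "a \<in> aff N"
  shows "{a} \<in> constr N"
proof -
  have "{a} = {x \<in> aff N. \<forall>i\<in>{..<N}. x i - a i = 0}"
    using assms by (auto simp: aff_def fun_eq_iff) (metis not_le lessThan_iff)
  then show ?thesis
    using constr_eqs[of "{..<N}" "\<lambda>i x. x i - a i"] by (simp add: polyfun_diff polyfun.intros)
qed

text \<open>The point of \<^term>\<open>aff 0\<close> is mapped onto a, because mapping a onto that point
  says nothing about its Euler characteristic.\<close>

lemma euler_char_singleton:
  assumes "euler_char chi" "a \<in> aff N"
  shows "chi {a} = 1"
proof -
  have one: "chi (aff 0) = 1" using assms(1) unfolding euler_char_def by blast
  have fib: "chi {x \<in> aff 0. (\<lambda>x. a) x = b} = 1" if "b \<in> {a}" for b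
    using that one by (simp add: aff_0)
  have "chi (aff 0) = 1 * chi {a}"
    by (rule euler_char_fibration[OF assms(1) constr_singleton[OF assms(2)] constr_aff _ _ fib])
      (auto intro: poly_mapI polyfun.pconst)
  then show ?thesis using one by simp
qed

text \<open>The fibres over the image are single points, so this is the fibration axiom with e =
  1.\<close>

lemma euler_char_inj_image:
  assumes "euler_char chi" "f ` B \<in> constr M" "B \<in> constr N" "poly_map f" "inj_on f B"
  shows "chi (f ` B) = chi B"
proof -
  have "chi B = 1 * chi (f ` B)"
  proof (rule euler_char_fibration[OF assms(1-4)])
    fix a assume "a \<in> f ` B"
    then obtain x where x: "x \<in> B" "a = f x" by blast
    then have "{y \<in> B. f y = a} = {x}" using assms(5) by (auto dest: inj_onD)
    then show "chi {y \<in> B. f y = a} = 1"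
      using euler_char_singleton[OF assms(1)] constr_subset_aff[OF assms(3)] x by (metis subsetD)
  qed simp
  then show ?thesis by simp
qed

text \<open>A substitute for Chevalley's theorem: \<open>y\<close> lies in the image exactly when
  \<open>g y\<close> lies in \<open>B\<close> and \<open>f (g y) = y\<close>, and both conditions
  are constructible in \<open>y\<close>.\<close>

lemma constr_image:
  assumes "B \<in> constr N" "poly_map f" "poly_map g" "f ` B \<subseteq> aff M"
    "\<And>y. y \<in> aff M \<Longrightarrow> g y \<in> aff N" "\<And>x. x \<in> B \<Longrightarrow> g (f x) = x"
  shows "f ` B \<in> constr M"
proof -
  have eq: "f ` B = {y \<in> {y \<in> aff M. g y \<in> B}. \<forall>i\<in>{..<M}. y i - f (g y) i = 0}" (is "_ = ?R")
  proof (intro equalityI subsetI)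
    fix y assume "y \<in> f ` B"
    then show "y \<in> ?R" using assms(4,6) by auto
  next
    fix y assume y: "y \<in> ?R"
    then have "f (g y) \<in> aff M" using assms(4) by auto
    then have "y = f (g y)" using y by (auto simp: aff_def fun_eq_iff) (metis not_le lessThan_iff)
    then show "y \<in> f ` B" using y by blast
  qed
  show ?thesis
    unfolding eq
    by (intro constr_restrict_eqs constr_preimage[OF assms(1,3)] polyfun_diff polyfun.pvar
        polyfun_comp[OF poly_map_component[OF assms(2)] assms(3)]) (use assms(5) in auto)
qed

section \<open>Torus actions\<close>

definition scale :: "(nat \<Rightarrow> int) \<Rightarrow> complex \<Rightarrow> (nat \<Rightarrow> complex) \<Rightarrow> (nat \<Rightarrow> complex)" where
  "scale w z x = (\<lambda>q. z powi w q * x q)"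

lemma scale_apply: "scale w z x q = z powi w q * x q"
  by (simp add: scale_def)

lemma poly_map_scale: "poly_map (scale w z)"
  unfolding scale_def by (intro poly_mapI polyfun.intros)

lemma scale_inverse: "z \<noteq> 0 \<Longrightarrow> scale w (inverse z) (scale w z x) = x"
  unfolding scale_def by (simp add: fun_eq_iff power_int_inverse)

text \<open>Nonconstant characters of the multiplicative group are surjective: take a root of order
  |m|, inverted if m is negative.\<close>

lemma exists_powi_eq:
  fixes a :: complex
  assumes "a \<noteq> 0" "m \<noteq> 0"
  shows "\<exists>z. z \<noteq> 0 \<and> z powi m = a"
proof -
  obtain y where y: "y ^ nat \<bar>m\<bar> = a"
  proof -
    have "card {z. z ^ nat \<bar>m\<bar> = a} = nat \<bar>m\<bar>" using assms by (intro card_nth_roots) auto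
    then have "{z. z ^ nat \<bar>m\<bar> = a} \<noteq> {}" using assms(2) by (intro notI) simp
    then show ?thesis using that by blast
  qed
  have y0: "y \<noteq> 0" using y assms by (auto simp: power_0_left split: if_splits)
  show ?thesis
  proof (cases "m \<ge> 0")
    case True
    then show ?thesis using y y0 by (intro exI[of _ y]) (auto simp: power_int_def)
  next
    case False
    then show ?thesis using y y0 by (intro exI[of _ "inverse y"]) (auto simp: power_int_def)
  qed
qed

lemma euler_char_scale:
  assumes chi: "euler_char chi" and "A \<in> constr N" "B \<in> constr N" "z \<noteq> 0"
    and "scale w z ` A \<subseteq> B" "scale w (inverse z) ` B \<subseteq> A"
  shows "chi A = chi B"
proof -
  have "scale w z ` A = B"
  proof
    show "B \<subseteq> scale w z ` A"
    proof
      fix x assume "x \<in> B"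
      then have "scale w (inverse z) x \<in> A" using assms(6) by blast
      moreover have "scale w z (scale w (inverse z) x) = x"
        using scale_inverse[of "inverse z" w x] \<open>z \<noteq> 0\<close> by simp
      ultimately show "x \<in> scale w z ` A" by (metis image_eqI)
    qed
  qed fact
  moreover have "inj_on (scale w z) A"
    by (rule inj_on_inverseI) (rule scale_inverse[OF \<open>z \<noteq> 0\<close>])
  ultimately show ?thesis
    using euler_char_inj_image[OF chi _ assms(2) poly_map_scale] assms(3) by metis
qed

text \<open>Where the coordinate \<open>q\<close> is nonzero, it defines a map to the punctured line, whose fibres
  are permuted transitively by the torus; the punctured line has Euler characteristic zero.\<close>

lemma euler_char_torus:
  assumes chi: "euler_char chi" and A: "A \<in> constr N"
    and stable: "\<And>z x. z \<noteq> 0 \<Longrightarrow> x \<in> A \<Longrightarrow> scale w z x \<in> A"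
    and wq: "w q \<noteq> 0"
  shows "chi {x \<in> A. x q = 0} = chi A"
proof -
  define Z where "Z = {x \<in> A. x q = 0}"
  define U where "U = A - Z"
  define P where "P = aff 1 - aff 0"
  define f :: "(nat \<Rightarrow> complex) \<Rightarrow> nat \<Rightarrow> complex" where "f x i = (if i = 0 then x q else 0)" for x i
  have Z: "Z \<in> constr N" unfolding Z_def by (intro constr_restrict_eq A polyfun.pvar)
  have U: "U \<in> constr N" unfolding U_def by (intro constr_Diff A Z)
  have aff0: "aff 0 \<in> constr 1" unfolding aff_0 by (rule constr_singleton) (simp add: aff_def)
  have P: "P \<in> constr 1" unfolding P_def by (intro constr_Diff constr_aff aff0)
  have "chi P = 0"
  proof -
    have "P \<union> aff 0 = aff 1" by (auto simp: P_def aff_def)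
    moreover have "chi (P \<union> aff 0) = chi P + chi (aff 0)"
      by (intro euler_char_Un[OF chi] constr_constructible[OF P] constr_constructible[OF aff0])
        (auto simp: P_def)
    ultimately show ?thesis using chi unfolding euler_char_def by simp
  qed
  have f: "poly_map f" unfolding f_def [abs_def] by (intro poly_map_cases polyfun.pvar)
  \<comment> \<open>For \<open>a\<close> off the line the equation \<open>x q = a 0\<close> does not
    describe the fibre, which is then empty.\<close>
  have fibre: "{x \<in> U. f x = a} \<in> constr N" for a
  proof (cases "\<forall>i>0. a i = 0")
    case True
    then have "{x \<in> U. f x = a} = {x \<in> U. x q - a 0 = 0}"
      by (auto simp: f_def fun_eq_iff)
    also have "\<dots> \<in> constr N" by (intro constr_restrict_eq U polyfun_diff polyfun.intros)
    finally show ?thesis .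
  next
    case False
    then obtain i where "i > 0" "a i \<noteq> 0" by blast
    then have "f x i \<noteq> a i" for x by (simp add: f_def)
    then have "{x \<in> U. f x = a} = {}" by auto
    then show ?thesis using constr_empty by (simp only:)
  qed
  define one :: "nat \<Rightarrow> complex" where "one i = (if i = 0 then 1 else 0)" for i
  have "chi {x \<in> U. f x = a} = chi {x \<in> U. f x = one}" if a: "a \<in> P" for a
  proof -
    have a0: "a 0 \<noteq> 0"
    proof
      assume "a 0 = 0"
      then have "a i = 0" for i using a by (cases i) (auto simp: P_def aff_def)
      then show False using a by (simp add: P_def aff_def)
    qed
    \<comment> \<open>This torus element multiplies the coordinate \<open>q\<close> by
      \<open>a 0\<close>, so it carries the fibre over \<open>one\<close> onto the fibre over
      \<open>a\<close>.\<close>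
    obtain z where z: "z \<noteq> 0" "z powi w q = a 0" using exists_powi_eq[OF a0 wq] by blast
    have ai: "a i = 0" if "i > 0" for i using a that by (simp add: P_def aff_def)
    have U': "scale w y x \<in> U" if "x \<in> U" "y \<noteq> 0" for x y
      using that stable by (auto simp: U_def Z_def scale_def)
    show ?thesis
    proof (rule euler_char_scale[OF chi fibre fibre, symmetric])
      show "z \<noteq> 0" by (rule z)
      show "scale w z ` {x \<in> U. f x = one} \<subseteq> {x \<in> U. f x = a}"
        using U' z ai by (auto simp: f_def scale_apply one_def fun_eq_iff)
      show "scale w (inverse z) ` {x \<in> U. f x = a} \<subseteq> {x \<in> U. f x = one}"
        using U' z ai a0 by (auto simp: f_def scale_apply one_def fun_eq_iff power_int_inverse)
    qed
  qed
  moreover have "f ` U \<subseteq> P"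
    by (auto simp: f_def P_def aff_def U_def Z_def fun_eq_iff dest: spec[of _ 0])
  ultimately have "chi U = chi {x \<in> U. f x = one} * chi P"
    by (intro euler_char_fibration[OF chi P U f])
  then have "chi U = 0" using \<open>chi P = 0\<close> by simp
  moreover have "chi (Z \<union> U) = chi Z + chi U"
    by (intro euler_char_Un[OF chi] constr_constructible[OF Z] constr_constructible[OF U])
      (auto simp: U_def)
  moreover have "Z \<union> U = A" by (auto simp: U_def Z_def)
  ultimately show ?thesis by (simp add: Z_def)
qed

text \<open>Each coordinate may use a torus of its own. All of them act diagonally, so the zeros
  already imposed survive the next action and the induction can continue.\<close>

lemma euler_char_torus_coordinates:
  assumes chi: "euler_char chi" and A: "A \<in> constr N" and "finite Q"
    and torus: "\<And>q. q \<in> Q \<Longrightarrow> \<exists>w. w q \<noteq> 0 \<and> (\<forall>z x. z \<noteq> 0 \<longrightarrow> x \<in> A \<longrightarrow> scale w z x \<in> A)"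
  shows "chi {x \<in> A. \<forall>q\<in>Q. x q = 0} = chi A"
  using \<open>finite Q\<close> torus
proof (induction Q rule: finite_induct)
  case (insert q Q)
  define AQ where "AQ = {x \<in> A. \<forall>q\<in>Q. x q = 0}"
  obtain w where w: "w q \<noteq> 0" "\<And>z x. z \<noteq> 0 \<Longrightarrow> x \<in> A \<Longrightarrow> scale w z x \<in> A"
    using insert.prems by blast
  have "chi {x \<in> AQ. x q = 0} = chi AQ"
  proof (rule euler_char_torus[where w = w, OF chi _ _ w(1)])
    show "AQ \<in> constr N"
      unfolding AQ_def using insert by (intro constr_restrict_eqs A polyfun.pvar)
    show "scale w z x \<in> AQ" if "z \<noteq> 0" "x \<in> AQ" for z x
      using that w(2) by (auto simp: AQ_def scale_def)
  qed
  moreover have "{x \<in> AQ. x q = 0} = {x \<in> A. \<forall>q\<in>insert q Q. x q = 0}"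
    by (auto simp: AQ_def)
  ultimately show ?case using insert by (simp add: AQ_def)
qed simp

section \<open>Submodules and triangular reduction\<close>

lemma submod_subset: "is_submod d U \<Longrightarrow> u \<in> U \<Longrightarrow> u \<in> Lset d"
  by (auto simp: is_submod_def)

lemma submod_add: "is_submod d U \<Longrightarrow> u \<in> U \<Longrightarrow> v \<in> U \<Longrightarrow> (\<lambda>k. u k + v k) \<in> U"
  by (auto simp: is_submod_def vadd_def)

lemma submod_smul: "is_submod d U \<Longrightarrow> u \<in> U \<Longrightarrow> (\<lambda>k. a * u k) \<in> U"
  by (auto simp: is_submod_def smul_def)

lemma submod_zero: "is_submod d U \<Longrightarrow> (\<lambda>k. 0) \<in> U"
  by (auto simp: is_submod_def)

lemma submod_diff:
  assumes "is_submod d U" "u \<in> U" "v \<in> U"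
  shows "(\<lambda>k. u k - v k) \<in> U"
  using submod_add[OF assms(1,2) submod_smul[OF assms(1,3), of "-1"]] by simp

lemma submod_sum:
  assumes "is_submod d U" "\<And>i. i \<in> I \<Longrightarrow> u i \<in> U"
  shows "(\<lambda>k. \<Sum>i\<in>I. a i * u i k) \<in> U"
proof (cases "finite I")
  case True
  then show ?thesis
    using assms(2)
  proof (induction I rule: finite_induct)
    case empty
    then show ?case using submod_zero[OF assms(1)] by simp
  next
    case (insert i I)
    then show ?case
      using submod_add[OF assms(1) submod_smul[OF assms(1), of "u i" "a i"], of "\<lambda>k. \<Sum>i\<in>I. a i * u i k"]
      by auto
  qed
qed (use submod_zero[OF assms(1)] in simp)

text \<open>Division with remainder: \<open>fps_shift (n i)\<close> is the quotient by t^(n i), so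
  step \<open>i\<close> leaves coordinate \<open>i\<close> with degree below \<open>n i\<close>.
  Rows are used from the top, because a row of an upper triangular matrix does not disturb the
  coordinates before its diagonal entry.\<close>

fun red :: "(nat \<Rightarrow> nat) \<Rightarrow> (nat \<Rightarrow> vec) \<Rightarrow> nat \<Rightarrow> vec \<Rightarrow> vec" where
  "red n M 0 v = v"
| "red n M (Suc i) v =
     (\<lambda>k. red n M i v k - fps_shift (n i) (red n M i v i) * M i k)"

definition reduced :: "nat \<Rightarrow> (nat \<Rightarrow> nat) \<Rightarrow> vec \<Rightarrow> bool" where
  "reduced d n v \<longleftrightarrow> (\<forall>k<d. \<forall>l\<ge>n k. fps_nth (v k) l = 0)"

text \<open>Off-diagonal entries carry no degree bound, so that the locale also covers the raw basis
  from which a normal form is built. Rows with index at least \<open>d\<close> vanish.\<close>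

locale triangular =
  fixes d :: nat and n :: "nat \<Rightarrow> nat" and M :: "nat \<Rightarrow> vec"
  assumes lower: "k < i \<Longrightarrow> M i k = 0"
    and diag: "i < d \<Longrightarrow> M i i = fps_X ^ n i"
    and outside: "d \<le> k \<Longrightarrow> M i k = 0"
begin

lemma submod_Xi: "is_submod d (Xi d M)"
  unfolding is_submod_def
proof (intro conjI ballI allI subsetI)
  show "(\<lambda>_. 0) \<in> Xi d M" unfolding Xi_def by (intro CollectI exI[of _ "\<lambda>_. 0"]) simp
next
  fix u assume "u \<in> Xi d M"
  then show "u \<in> Lset d" by (auto simp: Xi_def Lset_def outside)
next
  fix u v assume "u \<in> Xi d M" "v \<in> Xi d M"
  then obtain a b where "u = (\<lambda>k. \<Sum>i<d. a i * M i k)" "v = (\<lambda>k. \<Sum>i<d. b i * M i k)"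
    by (auto simp: Xi_def)
  then have "vadd u v = (\<lambda>k. \<Sum>i<d. (a i + b i) * M i k)"
    by (simp add: vadd_def distrib_right sum.distrib)
  then show "vadd u v \<in> Xi d M" unfolding Xi_def by (intro CollectI exI conjI TrueI)
next
  fix u s assume "u \<in> Xi d M"
  then obtain a where "u = (\<lambda>k. \<Sum>i<d. a i * M i k)" by (auto simp: Xi_def)
  then have "smul s u = (\<lambda>k. \<Sum>i<d. (s * a i) * M i k)"
    by (simp add: smul_def sum_distrib_left mult.assoc)
  then show "smul s u \<in> Xi d M" unfolding Xi_def by (intro CollectI exI conjI TrueI)
qed

lemma row_in_Xi: "i < d \<Longrightarrow> M i \<in> Xi d M"
  unfolding Xi_def
proof (intro CollectI exI conjI)
  assume "i < d"
  then show "M i = (\<lambda>k. \<Sum>j<d. (if j = i then 1 else 0) * M j k)"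
    by (simp add: if_distrib[of "\<lambda>x. x * _"] cong: if_cong)
qed simp

text \<open>Power series form a domain, so the leading zeros of \<open>v\<close> force the
  coefficients of the first \<open>i\<close> rows to vanish one after the other; only a multiple of
  t^(n i) is left in coordinate \<open>i\<close>.\<close>

lemma Xi_leading:
  assumes "v \<in> Xi d M" "i < d" "\<And>k. k < i \<Longrightarrow> v k = 0" "l < n i"
  shows "fps_nth (v i) l = 0"
proof -
  obtain a where a: "v = (\<lambda>k. \<Sum>j<d. a j * M j k)" using assms(1) by (auto simp: Xi_def)
  have coord: "v k = a k * fps_X ^ n k" if "k < d" "\<And>j. j < k \<Longrightarrow> a j = 0" for k
  proof -
    have "v k = (\<Sum>j<d. if j = k then a k * fps_X ^ n k else 0)"
      unfolding a
    proof (rule sum.cong)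
      fix j assume "j \<in> {..<d}"
      then show "a j * M j k = (if j = k then a k * fps_X ^ n k else 0)"
        using that diag[of k] lower[of k j] by (cases j k rule: linorder_cases) auto
    qed simp
    then show ?thesis using that by simp
  qed
  have "k < i \<Longrightarrow> a k = 0" for k
  proof (induction k rule: less_induct)
    case (less k)
    then have "v k = a k * fps_X ^ n k" using assms(2) by (intro coord) auto
    then show ?case using assms(3)[OF less.prems] by simp
  qed
  then have "v i = a i * fps_X ^ n i" using assms(2) by (intro coord)
  then show ?thesis using assms(4) by (simp add: fps_X_power_mult_right_nth)
qed

text \<open>The source of all uniqueness statements: once the earlier coordinates vanish,
  \<open>Xi_leading\<close> removes the degrees below \<open>n k\<close> and reducedness removes the
  others.\<close>

lemma Xi_reduced_zero:
  assumes "v \<in> Xi d M" "reduced d n v"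
  shows "v = (\<lambda>_. 0)"
proof
  fix k show "v k = 0"
  proof (induction k rule: less_induct)
    case (less k)
    show ?case
    proof (cases "k < d")
      case True
      have "fps_nth (v k) l = 0" for l
        using Xi_leading[OF assms(1) True] less assms(2) True
        by (cases "l < n k") (auto simp: reduced_def)
      then show ?thesis by (simp add: fps_eq_iff)
    next
      case False
      then show ?thesis using submod_subset[OF submod_Xi assms(1)] by (simp add: Lset_def)
    qed
  qed
qed

lemma red_reduced:
  assumes "i \<le> d" "k < i" "n k \<le> l"
  shows "fps_nth (red n M i v k) l = 0"
  using assms
proof (induction i)
  case (Suc i)
  show ?case
  proof (cases "k = i")
    case True
    then show ?thesis using Suc.prems diag[of i] by (simp add: fps_X_power_mult_right_nth)
  next
    case False
    then show ?thesis using Suc lower[of k i] by simp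
  qed
qed simp

lemma reduced_red: "reduced d n (red n M d v)"
  using red_reduced by (auto simp: reduced_def)

lemma diff_red_in_Xi:
  assumes "i \<le> d"
  shows "(\<lambda>k. v k - red n M i v k) \<in> Xi d M"
  using assms
proof (induction i)
  case 0
  then show ?case using submod_zero[OF submod_Xi] by simp
next
  case (Suc i)
  have "(\<lambda>k. (v k - red n M i v k) + fps_shift (n i) (red n M i v i) * M i k) \<in> Xi d M"
    using Suc by (intro submod_add[OF submod_Xi] submod_smul[OF submod_Xi] row_in_Xi) auto
  then show ?case by (simp add: algebra_simps)
qed

lemma red_unique:
  assumes "w \<in> Xi d M" "reduced d n (\<lambda>k. v k - w k)"
  shows "red n M d v = (\<lambda>k. v k - w k)"
proof -
  have "(\<lambda>k. (v k - red n M d v k) - w k) = (\<lambda>_. 0)"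
    using assms reduced_red[of v]
    by (intro Xi_reduced_zero submod_diff[OF submod_Xi] diff_red_in_Xi)
      (auto simp: reduced_def)
  then show ?thesis by (auto simp: fun_eq_iff algebra_simps)
qed

lemma red_in_Lset:
  assumes "v \<in> Lset d"
  shows "red n M d v \<in> Lset d"
  using assms submod_subset[OF submod_Xi diff_red_in_Xi[of d v]] by (auto simp: Lset_def)

lemma in_Xi_iff: "v \<in> Xi d M \<longleftrightarrow> red n M d v = (\<lambda>_. 0)"
proof
  assume "v \<in> Xi d M"
  then show "red n M d v = (\<lambda>_. 0)"
    using red_unique[of v v] by (simp add: reduced_def)
next
  assume "red n M d v = (\<lambda>_. 0)"
  then show "v \<in> Xi d M" using diff_red_in_Xi[of d v] by simp
qed

text \<open>A remainder has only finitely many coefficients that can be nonzero. Membership thus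
  becomes finitely many equations, which is what makes \<open>Fset\<close> constructible.\<close>

lemma in_Xi_iff_coeffs:
  assumes "v \<in> Lset d"
  shows "v \<in> Xi d M \<longleftrightarrow> (\<forall>k<d. \<forall>l<n k. fps_nth (red n M d v k) l = 0)"
proof -
  have "red n M d v k = 0" if "\<forall>k<d. \<forall>l<n k. fps_nth (red n M d v k) l = 0" for k
  proof (cases "k < d")
    case True
    then have "fps_nth (red n M d v k) l = 0" for l
      using that reduced_red[of v] by (cases "l < n k") (auto simp: reduced_def)
    then show ?thesis by (simp add: fps_eq_iff)
  next
    case False
    then show ?thesis using red_in_Lset[OF assms] by (simp add: Lset_def)
  qed
  then show ?thesis unfolding in_Xi_iff by (auto simp: fun_eq_iff)
qed

text \<open>Row \<open>i\<close> absorbs an entry of order at least \<open>n i\<close> completely,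
  so the remainder moves strictly behind coordinate \<open>i\<close>. This gives the echelon vectors
  their leading position.\<close>

lemma red_leading:
  assumes "i < d" "\<And>k. k < i \<Longrightarrow> v k = 0" "\<And>l. l < n i \<Longrightarrow> fps_nth (v i) l = 0" "k \<le> i"
  shows "red n M d v k = 0"
  using assms(4)
proof (induction k rule: less_induct)
  case (less k)
  have w: "(\<lambda>k. v k - red n M d v k) \<in> Xi d M" using diff_red_in_Xi by simp
  have "fps_nth (red n M d v k) l = 0" for l
  proof (cases "l < n k")
    case True
    have "fps_nth (v k - red n M d v k) l = 0"
      using Xi_leading[OF w, of k l] True less assms(1,2) by simp
    moreover have "fps_nth (v k) l = 0"
      using assms(2,3) True less.prems by (cases "k = i") auto
    ultimately show ?thesis by simp
  next
    case False
    then show ?thesis using reduced_red[of v] less.prems assms(1) by (auto simp: reduced_def)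
  qed
  then show ?case by (simp add: fps_eq_iff)
qed

text \<open>The determinant kills the quotient by \<open>Xi\<close>; for a vector that starts at
  coordinate \<open>i\<close>, the lower right minor suffices.\<close>

lemma X_power_smul_in_Xi:
  assumes "v \<in> Lset d" "\<And>k. k < i \<Longrightarrow> v k = 0" "i \<le> d"
  shows "(\<lambda>k. fps_X ^ (\<Sum>j\<in>{i..<d}. n j) * v k) \<in> Xi d M"
  using assms(3,1,2)
proof (induction i arbitrary: v rule: inc_induct)
  case base
  then have "v = (\<lambda>_. 0)" by (auto simp: Lset_def fun_eq_iff) (meson not_le)
  then show ?case using submod_zero[OF submod_Xi] by simp
next
  case (step i)
  \<comment> \<open>Cross-multiplying with row \<open>i\<close> cancels coordinate \<open>i\<close>
    at the cost of one factor t^(n i), so \<open>w\<close> starts one coordinate later.\<close>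
  define w where "w k = fps_X ^ n i * v k - v i * M i k" for k
  have "(\<lambda>k. fps_X ^ (\<Sum>j\<in>{Suc i..<d}. n j) * w k) \<in> Xi d M"
  proof (rule step.IH)
    show "w \<in> Lset d" using step.prems outside by (auto simp: Lset_def w_def)
    show "w k = 0" if "k < Suc i" for k
      using that step.prems step.hyps diag[of i] lower[of k i]
      by (cases "k = i") (auto simp: w_def mult.commute)
  qed
  then have "(\<lambda>k. fps_X ^ (\<Sum>j\<in>{Suc i..<d}. n j) * w k +
      (fps_X ^ (\<Sum>j\<in>{Suc i..<d}. n j) * v i) * M i k) \<in> Xi d M"
    by (rule submod_add[OF submod_Xi _ submod_smul[OF submod_Xi row_in_Xi[OF \<open>i < d\<close>]]])
  moreover have "(\<Sum>j\<in>{i..<d}. n j) = n i + (\<Sum>j\<in>{Suc i..<d}. n j)"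
    using step.hyps by (simp add: sum.atLeast_Suc_lessThan)
  ultimately show ?case
    by (simp add: w_def power_add algebra_simps)
qed

end

text \<open>The exponent \<open>n i\<close> is the least order of coordinate \<open>i\<close> among
  the elements of \<open>Xi\<close> whose earlier coordinates vanish, so the submodule determines
  it. By symmetry one inequality is enough.\<close>

lemma Xi_eq_imp_diag_eq:
  assumes "triangular d n M" "triangular d m M'" "Xi d M = Xi d M'" "i < d"
  shows "n i = m i"
proof -
  have "n i \<le> m i" if "triangular d n M" "triangular d m M'" "Xi d M = Xi d M'" for n m M M'
  proof (rule ccontr)
    assume "\<not> n i \<le> m i"
    moreover have "M' i \<in> Xi d M" using that triangular.row_in_Xi assms(4) by metis
    ultimately have "fps_nth (M' i i) (m i) = 0"
      using triangular.Xi_leading[OF that(1) _ assms(4)] triangular.lower[OF that(2)] by simp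
    then show False using triangular.diag[OF that(2) assms(4)] by simp
  qed
  from this[OF assms(1-3)] this[OF assms(2,1) assms(3)[symmetric]] show ?thesis by simp
qed

section \<open>Polynomial families of power series\<close>

text \<open>Polynomiality is asked coefficient by coefficient, without a common degree bound. Each
  coefficient of a product involves finitely many coefficients of the factors, so the class is
  closed under products.\<close>

definition pser :: "((nat \<Rightarrow> complex) \<Rightarrow> complex fps) set" where
  "pser = {f. \<forall>l. (\<lambda>x. fps_nth (f x) l) \<in> polyfun}"

lemma pserI: "(\<And>l. (\<lambda>x. fps_nth (f x) l) \<in> polyfun) \<Longrightarrow> f \<in> pser"
  by (simp add: pser_def)

lemma pser_nth: "f \<in> pser \<Longrightarrow> (\<lambda>x. fps_nth (f x) l) \<in> polyfun"
  by (simp add: pser_def)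

lemma pser_const: "(\<lambda>x. a) \<in> pser"
  by (simp add: pser_def polyfun.pconst)

lemma pser_diff: "f \<in> pser \<Longrightarrow> g \<in> pser \<Longrightarrow> (\<lambda>x. f x - g x) \<in> pser"
  by (simp add: pser_def polyfun_diff)

lemma pser_mult: "f \<in> pser \<Longrightarrow> g \<in> pser \<Longrightarrow> (\<lambda>x. f x * g x) \<in> pser"
  by (simp add: pser_def fps_mult_nth polyfun_sum polyfun.pmult)

lemma pser_sum: "(\<And>i. i \<in> I \<Longrightarrow> f i \<in> pser) \<Longrightarrow> (\<lambda>x. \<Sum>i\<in>I. f i x) \<in> pser"
  by (simp add: pser_def fps_sum_nth polyfun_sum)

lemma pser_shift: "f \<in> pser \<Longrightarrow> (\<lambda>x. fps_shift m (f x)) \<in> pser"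
  by (simp add: pser_def)

lemma pser_red:
  assumes "\<And>i k. (\<lambda>x. M x i k) \<in> pser" "\<And>k. (\<lambda>x. v x k) \<in> pser"
  shows "(\<lambda>x. red n (M x) i (v x) k) \<in> pser"
  by (induction i arbitrary: k) (simp_all add: assms pser_diff pser_mult pser_shift)

lemma pser_lbr:
  assumes "\<And>k. (\<lambda>x. u x k) \<in> pser" "\<And>k. (\<lambda>x. v x k) \<in> pser"
  shows "(\<lambda>x. lbr d c (u x) (v x) k) \<in> pser"
  by (cases "k < d") (simp_all add: lbr_def pser_const pser_sum pser_mult assms)

section \<open>The parameter spaces\<close>

lemma tcoord_less:
  assumes "i < d" "j < d" "l < (\<Sum>r<d. n r)"
  shows "tcoord d n i j l < d * d * (\<Sum>r<d. n r)"
proof -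
  define S where "S = (\<Sum>r<d. n r)"
  have "i * d + j < d * d"
  proof -
    have "i * d + j < Suc i * d" using assms(2) by simp
    also have "\<dots> \<le> d * d" using assms(1) by (intro mult_le_mono1) simp
    finally show ?thesis .
  qed
  then have "(i * d + j) * S + S \<le> d * d * S"
    by (metis Suc_leI add.commute mult_Suc mult_le_mono1)
  then show ?thesis using assms(3) unfolding tcoord_def S_def[symmetric] by linarith
qed

lemma tcoord_decode:
  assumes "j < d" "l < (\<Sum>r<d. n r)"
  shows "tcoord d n i j l div (\<Sum>r<d. n r) div d = i"
    "tcoord d n i j l div (\<Sum>r<d. n r) mod d = j"
    "tcoord d n i j l mod (\<Sum>r<d. n r) = l"
proof -
  have "(\<Sum>r<d. n r) \<noteq> 0" using assms(2) by linarith
  then have "tcoord d n i j l div (\<Sum>r<d. n r) = i * d + j"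
    using assms(2) unfolding tcoord_def by (subst div_mult_self3) simp_all
  then show "tcoord d n i j l div (\<Sum>r<d. n r) div d = i"
    "tcoord d n i j l div (\<Sum>r<d. n r) mod d = j"
    using assms(1) by simp_all
  show "tcoord d n i j l mod (\<Sum>r<d. n r) = l"
    using assms(2) unfolding tcoord_def by simp
qed

lemma less_sum_diag:
  fixes n :: "nat \<Rightarrow> nat"
  assumes "j < d" "l < n j"
  shows "l < (\<Sum>r<d. n r)"
  using member_le_sum[of j "{..<d}" n] assms by simp

lemma Tset_constr: "Tset d n \<in> constr (d * d * (\<Sum>r<d. n r))"
proof -
  define K where "K = d * d * (\<Sum>r<d. n r)"
  have "tvalid d n \<subseteq> {..<K}"
    unfolding tvalid_def K_def using tcoord_less less_sum_diag
    by (auto intro: order.strict_trans)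
  then have "Tset d n = {x \<in> aff K. \<forall>q\<in>{..<K} - tvalid d n. x q = 0}"
    by (auto simp: Tset_def aff_def) (metis not_le DiffI lessThan_iff)
  also have "\<dots> \<in> constr K" by (intro constr_eqs polyfun.pvar) simp
  finally show ?thesis by (simp add: K_def)
qed

lemma triangular_tmat: "triangular d n (tmat d n x)"
  by unfold_locales (auto simp: tmat_def)

lemma tmat_upper:
  "i < j \<Longrightarrow> j < d \<Longrightarrow> fps_nth (tmat d n x i j) l = (if l < n j then x (tcoord d n i j l) else 0)"
  by (simp add: tmat_def)

lemma pser_tmat: "(\<lambda>x. tmat d n x i k) \<in> pser"
proof (rule pserI)
  fix l
  show "(\<lambda>x. fps_nth (tmat d n x i k) l) \<in> polyfun"
    by (cases "i < d"; cases "k < d"; cases i k rule: linorder_cases; cases "l < n k")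
      (simp_all add: tmat_def polyfun.pconst polyfun.pvar)
qed

lemma tmat_eq_imp_eq:
  assumes "x \<in> Tset d n" "y \<in> Tset d n" "tmat d n x = tmat d n y"
  shows "x = y"
proof
  fix q show "x q = y q"
  proof (cases "q \<in> tvalid d n")
    case True
    then obtain i j l where "q = tcoord d n i j l" "i < j" "j < d" "l < n j"
      by (auto simp: tvalid_def)
    then show ?thesis using tmat_upper[of i j d n _ l] assms(3) by metis
  qed (use assms in \<open>auto simp: Tset_def\<close>)
qed

text \<open>Rows with the same index share their diagonal entry, which cancels in the difference;
  what remains is a reduced element of the submodule, hence zero.\<close>

lemma Xi_tmat_inj:
  assumes "x \<in> Tset d n" "y \<in> Tset d n" "Xi d (tmat d n x) = Xi d (tmat d n y)"
  shows "x = y"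
proof (rule tmat_eq_imp_eq[OF assms(1,2)], rule ext)
  interpret triangular d n "tmat d n x" by (rule triangular_tmat)
  fix i
  show "tmat d n x i = tmat d n y i"
  proof (cases "i < d")
    case True
    have "(\<lambda>k. tmat d n x i k - tmat d n y i k) = (\<lambda>_. 0)"
    proof (rule Xi_reduced_zero)
      show "(\<lambda>k. tmat d n x i k - tmat d n y i k) \<in> Xi d (tmat d n x)"
        using row_in_Xi[OF True] triangular.row_in_Xi[OF triangular_tmat True, of n y]
        by (intro submod_diff[OF submod_Xi]) (simp_all add: assms(3))
      show "reduced d n (\<lambda>k. tmat d n x i k - tmat d n y i k)"
        using True by (auto simp: reduced_def tmat_def)
    qed
    then show ?thesis by (auto simp: fun_eq_iff)
  qed (auto simp: tmat_def fun_eq_iff)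
qed

section \<open>Testing closure under the bracket on generators\<close>

definition unit_vec :: "nat \<Rightarrow> vec" where
  "unit_vec i = (\<lambda>k. if k = i then 1 else 0)"

lemma lbr_in_Lset: "lbr d c u v \<in> Lset d"
  by (simp add: lbr_def Lset_def)

lemma lbr_sum_left:
  "lbr d c (\<lambda>k. \<Sum>i\<in>I. a i * u i k) v = (\<lambda>k. \<Sum>i\<in>I. a i * lbr d c (u i) v k)"
proof
  fix k
  have "(\<Sum>p<d. \<Sum>q<d. (\<Sum>i\<in>I. a i * u i p) * v q * c p q k) =
      (\<Sum>p<d. \<Sum>q<d. \<Sum>i\<in>I. a i * (u i p * v q * c p q k))"
    by (simp add: sum_distrib_right mult.assoc)
  also have "\<dots> = (\<Sum>p<d. \<Sum>i\<in>I. \<Sum>q<d. a i * (u i p * v q * c p q k))"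
    by (rule sum.cong[OF refl]) (rule sum.swap)
  also have "\<dots> = (\<Sum>i\<in>I. \<Sum>p<d. \<Sum>q<d. a i * (u i p * v q * c p q k))"
    by (rule sum.swap)
  finally show "lbr d c (\<lambda>k. \<Sum>i\<in>I. a i * u i k) v k = (\<Sum>i\<in>I. a i * lbr d c (u i) v k)"
    by (simp add: lbr_def sum_distrib_left)
qed

text \<open>Transposing the structure constants turns linearity in the left argument into linearity
  in the right one.\<close>

lemma lbr_swap: "lbr d c u v = lbr d (\<lambda>i j. c j i) v u"
proof
  fix k
  have "(\<Sum>i<d. \<Sum>j<d. u i * v j * c i j k) = (\<Sum>j<d. \<Sum>i<d. u i * v j * c i j k)"
    by (rule sum.swap)
  then show "lbr d c u v k = lbr d (\<lambda>i j. c j i) v u k" by (simp add: lbr_def mult.commute)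
qed

lemma lbr_sum_right:
  "lbr d c v (\<lambda>k. \<Sum>i\<in>I. a i * u i k) = (\<lambda>k. \<Sum>i\<in>I. a i * lbr d c v (u i) k)"
  by (subst (1 2) lbr_swap) (rule lbr_sum_left)

lemma Lset_expand:
  assumes "u \<in> Lset d"
  shows "u = (\<lambda>k. \<Sum>i<d. u i * unit_vec i k)"
  using assms by (auto simp: fun_eq_iff unit_vec_def Lset_def if_distrib[of "\<lambda>x. _ * x"] cong: if_cong)

text \<open>Generators for the left argument of the bracket: those of the submodule for subalgebras,
  those of L for ideals. Both kinds can then share the later proofs.\<close>

fun left_factor :: "subkind \<Rightarrow> (nat \<Rightarrow> vec) \<Rightarrow> nat \<Rightarrow> vec" where
  "left_factor Subalg M i = M i"
| "left_factor Ideal M i = unit_vec i"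

lemma (in triangular) good_iff_generators:
  "good d c kind (Xi d M) \<longleftrightarrow> (\<forall>i<d. \<forall>j<d. lbr d c (left_factor kind M i) (M j) \<in> Xi d M)"
proof
  assume "good d c kind (Xi d M)"
  moreover have "unit_vec i \<in> Lset d" if "i < d" for i using that by (simp add: unit_vec_def Lset_def)
  ultimately show "\<forall>i<d. \<forall>j<d. lbr d c (left_factor kind M i) (M j) \<in> Xi d M"
    by (cases kind) (auto simp: good_def row_in_Xi)
next
  assume gen: "\<forall>i<d. \<forall>j<d. lbr d c (left_factor kind M i) (M j) \<in> Xi d M"
  have closed: "lbr d c (\<lambda>k. \<Sum>i<d. a i * left_factor kind M i k) v \<in> Xi d M"
    if v: "v \<in> Xi d M" for a v
  proof -
    obtain b where "v = (\<lambda>k. \<Sum>j<d. b j * M j k)" using v by (auto simp: Xi_def)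
    then show ?thesis
      using gen by (auto simp: lbr_sum_left lbr_sum_right intro!: submod_sum[OF submod_Xi])
  qed
  show "good d c kind (Xi d M)"
  proof (cases kind)
    case Subalg
    have "lbr d c u v \<in> Xi d M" if u: "u \<in> Xi d M" and v: "v \<in> Xi d M" for u v
    proof -
      obtain a where "u = (\<lambda>k. \<Sum>i<d. a i * M i k)" using u by (auto simp: Xi_def)
      then show ?thesis using closed[OF v, of a] Subalg by simp
    qed
    then show ?thesis using Subalg by (simp add: good_def submod_Xi)
  next
    case Ideal
    have "lbr d c u v \<in> Xi d M" if "u \<in> Lset d" "v \<in> Xi d M" for u v
      using closed[OF that(2), of u] Ideal Lset_expand[OF that(1)] by simp
    then show ?thesis using Ideal by (simp add: good_def submod_Xi)
  qed
qed

text \<open>The equations are the coefficients of the remainders of brackets of generators. These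
  arise from the matrix entries by sums, products and shifts, so they are polynomial.\<close>

lemma Fset_constr: "Fset d c kind n \<in> constr (d * d * (\<Sum>r<d. n r))"
proof -
  define g where "g x i j = lbr d c (left_factor kind (tmat d n x) i) (tmat d n x j)" for x i j
  define I where "I = {..<d} \<times> {..<d} \<times> (SIGMA k:{..<d}. {..<n k})"
  define p where "p = (\<lambda>(i, j, k, l) x. fps_nth (red n (tmat d n x) d (g x i j) k) l)"
  have "(\<forall>i<d. \<forall>j<d. g x i j \<in> Xi d (tmat d n x)) \<longleftrightarrow> (\<forall>t\<in>I. p t x = 0)" for x
  proof -
    have "g x i j \<in> Xi d (tmat d n x) \<longleftrightarrow>
        (\<forall>k<d. \<forall>l<n k. fps_nth (red n (tmat d n x) d (g x i j) k) l = 0)" for i j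
      by (rule triangular.in_Xi_iff_coeffs[OF triangular_tmat]) (simp add: g_def lbr_in_Lset)
    then show ?thesis by (auto simp: I_def p_def)
  qed
  then have eq: "Fset d c kind n = {x \<in> Tset d n. \<forall>t\<in>I. p t x = 0}"
    unfolding Fset_def triangular.good_iff_generators[OF triangular_tmat] g_def by blast
  have lf: "(\<lambda>x. left_factor kind (tmat d n x) i k) \<in> pser" for i k
    by (cases kind) (simp_all add: pser_tmat pser_const)
  have "(\<lambda>x. g x i j k) \<in> pser" for i j k
    unfolding g_def by (rule pser_lbr) (simp_all add: lf pser_tmat)
  then have "p t \<in> polyfun" for t
    unfolding p_def by (cases t) (simp add: pser_nth pser_red pser_tmat)
  then show ?thesis
    unfolding eq by (intro constr_restrict_eqs Tset_constr) (auto simp: I_def)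
qed

section \<open>Reduced row echelon matrices\<close>

definition rref_at :: "nat \<Rightarrow> nat \<Rightarrow> (nat \<Rightarrow> nat \<Rightarrow> complex) \<Rightarrow> (nat \<Rightarrow> nat) \<Rightarrow> bool" where
  "rref_at N k R p \<longleftrightarrow> strict_mono_on {..<k} p \<and>
     (\<forall>r<k. p r < N \<and> R r (p r) = 1 \<and> (\<forall>c<p r. R r c = 0) \<and>
        (\<forall>r'<k. r' \<noteq> r \<longrightarrow> R r' (p r) = 0)) \<and>
     (\<forall>r c. k \<le> r \<or> N \<le> c \<longrightarrow> R r c = 0)"

lemma rref_iff: "rref N k R \<longleftrightarrow> (\<exists>p. rref_at N k R p)"
  unfolding rref_def rref_at_def by (simp only: ex_simps conj_assoc[symmetric])

lemma row_in_rowspace: "r < k \<Longrightarrow> R r \<in> rowspace k R"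
  unfolding rowspace_def
  by (intro CollectI exI[of _ "\<lambda>s. if s = r then 1 else 0"])
    (simp add: if_distrib[of "\<lambda>x. x * _"] cong: if_cong)

lemma rowspace_diff:
  assumes "v \<in> rowspace k R" "w \<in> rowspace k R"
  shows "(\<lambda>c. v c - w c) \<in> rowspace k R"
proof -
  obtain a b where "v = (\<lambda>c. \<Sum>r<k. a r * R r c)" "w = (\<lambda>c. \<Sum>r<k. b r * R r c)"
    using assms by (auto simp: rowspace_def)
  then have "(\<lambda>c. v c - w c) = (\<lambda>c. \<Sum>r<k. (a r - b r) * R r c)"
    by (simp add: left_diff_distrib sum_subtractf)
  then show ?thesis unfolding rowspace_def by (intro CollectI exI conjI TrueI)
qed

text \<open>In a pivot column only one row is nonzero, so the entry there is the coefficient of that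
  row.\<close>

lemma rowspace_coeffs:
  assumes "rref_at N k R p" "v \<in> rowspace k R"
  shows "v = (\<lambda>c. \<Sum>r<k. v (p r) * R r c)"
proof -
  obtain a where a: "v = (\<lambda>c. \<Sum>r<k. a r * R r c)" using assms(2) by (auto simp: rowspace_def)
  have "v (p s) = a s" if "s < k" for s
  proof -
    have "v (p s) = (\<Sum>r<k. if r = s then a s else 0)"
      unfolding a using assms(1) that by (intro sum.cong) (auto simp: rref_at_def)
    then show ?thesis using that by simp
  qed
  then show ?thesis unfolding a by simp
qed

text \<open>Describes the pivot columns through the subspace alone, without a matrix spanning
  it.\<close>

definition leading :: "(nat \<Rightarrow> complex) set \<Rightarrow> nat set" where
  "leading W = {c. \<exists>w\<in>W. w c \<noteq> 0 \<and> (\<forall>c'<c. w c' = 0)}"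

lemma rref_at_leading:
  assumes "rref_at N k R p"
  shows "leading (rowspace k R) = p ` {..<k}"
proof (intro equalityI subsetI)
  fix c assume "c \<in> p ` {..<k}"
  then obtain r where "r < k" "c = p r" by blast
  then show "c \<in> leading (rowspace k R)"
    using assms unfolding leading_def rref_at_def
    by (intro CollectI bexI[OF _ row_in_rowspace[of r]]) auto
next
  fix c assume "c \<in> leading (rowspace k R)"
  then obtain w where w: "w \<in> rowspace k R" "w c \<noteq> 0" "\<forall>c'<c. w c' = 0"
    by (auto simp: leading_def)
  have wc: "w e = (\<Sum>r<k. w (p r) * R r e)" for e
    using rowspace_coeffs[OF assms w(1)] by (rule fun_cong)
  obtain r where r: "r < k" "w (p r) * R r c \<noteq> 0"
  proof (rule ccontr)
    assume "\<not> thesis"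
    then have "(\<Sum>r<k. w (p r) * R r c) = 0" using that by (intro sum.neutral) auto
    then show False using w(2) wc[of c] by metis
  qed
  \<comment> \<open>A row that contributes at \<open>c\<close> starts at or before \<open>c\<close>;
    had it started earlier, \<open>w\<close> would be nonzero at its pivot, before its own leading
    position.\<close>
  have "p r \<le> c" using r assms unfolding rref_at_def by (metis mult_zero_right not_le)
  moreover have "\<not> p r < c" using r w(3) by auto
  ultimately show "c \<in> p ` {..<k}" using r by auto
qed

lemma strict_mono_on_lessThan_unique:
  fixes p p' :: "nat \<Rightarrow> nat"
  assumes "strict_mono_on {..<k} p" "strict_mono_on {..<k'} p'" "p ` {..<k} = p' ` {..<k'}"
  shows "k = k'" "\<And>r. r < k \<Longrightarrow> p r = p' r"
proof -
  have "sorted_wrt (<) (map f [0..<m])" if "strict_mono_on {..<m} f" for f :: "nat \<Rightarrow> nat" and m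
    using that by (auto simp: sorted_wrt_iff_nth_less strict_mono_on_def)
  then have eq: "map p [0..<k] = map p' [0..<k']"
    using assms by (intro strict_sorted_equal) (auto simp: atLeast0LessThan)
  show "k = k'" using arg_cong[OF eq, of length] by simp
  then show "p r = p' r" if "r < k" for r
    using that arg_cong[OF eq, of "\<lambda>xs. xs ! r"] by simp
qed

text \<open>Equal row spaces have equal leading positions, hence equal pivots. The difference of
  corresponding rows lies in the row space and vanishes at every pivot, so it is zero.\<close>

lemma rref_unique:
  assumes "rref N k R" "rref N k' R'" "rowspace k R = rowspace k' R'"
  shows "k = k'" "R = R'"
proof -
  obtain p p' where p: "rref_at N k R p" "rref_at N k' R' p'" using assms by (auto simp: rref_iff)
  then have im: "p ` {..<k} = p' ` {..<k'}"
    using rref_at_leading assms(3) by metis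
  have mono: "strict_mono_on {..<k} p" "strict_mono_on {..<k'} p'"
    using p by (auto simp: rref_at_def)
  show k: "k = k'" by (rule strict_mono_on_lessThan_unique(1)[OF mono im])
  have pp: "p r = p' r" if "r < k" for r
    by (rule strict_mono_on_lessThan_unique(2)[OF mono im that])
  have "R r c = R' r c" for r c
  proof (cases "r < k")
    case True
    define w where "w c = R r c - R' r c" for c
    have "w \<in> rowspace k R"
      unfolding w_def using True k assms(3) row_in_rowspace
      by (intro rowspace_diff) auto
    moreover have "w (p s) = 0" if "s < k" for s
    proof -
      have "R r (p s) = (if r = s then 1 else 0)" "R' r (p' s) = (if r = s then 1 else 0)"
        using p True that k by (auto simp: rref_at_def)
      then show ?thesis using pp[OF that] by (simp add: w_def)
    qed
    ultimately have "w = (\<lambda>c. 0)" using rowspace_coeffs[OF p(1)] by (metis (no_types, lifting) lessThan_iff mult_zero_left sum.neutral)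
    then show ?thesis by (simp add: w_def fun_eq_iff)
  next
    case False
    then show ?thesis using p k by (simp add: rref_at_def)
  qed
  then show "R = R'" by blast
qed

lemma flat_inj:
  assumes "rref N k R" "rref N k R'" "flat N k R = flat N k R'"
  shows "R = R'"
proof -
  have "R r c = R' r c" for r c
  proof (cases "r < k \<and> c < N")
    case True
    have "r * N + c < k * N"
    proof -
      have "r * N + c < Suc r * N" using True by simp
      also have "\<dots> \<le> k * N" using True by (intro mult_le_mono1) simp
      finally show ?thesis .
    qed
    then show ?thesis using True fun_cong[OF assms(3), of "r * N + c"] by (simp add: flat_def)
  next
    case False
    then show ?thesis using assms by (auto simp: rref_iff rref_at_def)
  qed
  then show ?thesis by blast
qed

section \<open>The echelon form of a triangular submodule\<close>

text \<open>Column i*N + l stands for t^l x_i. The pivots are the monomials that lead elements of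
  \<open>Xi\<close>; the other columns support the remainders.\<close>

definition pivots :: "nat \<Rightarrow> (nat \<Rightarrow> nat) \<Rightarrow> nat \<Rightarrow> nat set" where
  "pivots d n N = {q. q < d * N \<and> n (q div N) \<le> q mod N}"

definition monom_vec :: "nat \<Rightarrow> nat \<Rightarrow> vec" where
  "monom_vec N q = (\<lambda>k. if k = q div N then fps_X ^ (q mod N) else 0)"

text \<open>Subtracting its remainder puts the monomial into \<open>Xi\<close>. The remainder is
  supported outside the pivots, so at the pivots only the entry 1 of a pivot monomial
  survives.\<close>

definition echelon_vec :: "nat \<Rightarrow> (nat \<Rightarrow> nat) \<Rightarrow> (nat \<Rightarrow> vec) \<Rightarrow> nat \<Rightarrow> nat \<Rightarrow> vec" where
  "echelon_vec d n M N q = (\<lambda>k. monom_vec N q k - red n M d (monom_vec N q) k)"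

definition echelon :: "nat \<Rightarrow> (nat \<Rightarrow> nat) \<Rightarrow> (nat \<Rightarrow> vec) \<Rightarrow> nat \<Rightarrow> nat \<Rightarrow> nat \<Rightarrow> complex" where
  "echelon d n M N r = (if r < card (pivots d n N)
     then trunc d N (echelon_vec d n M N (sorted_list_of_set (pivots d n N) ! r)) else (\<lambda>_. 0))"

lemma finite_pivots: "finite (pivots d n N)"
  by (rule finite_subset[of _ "{..<d * N}"]) (auto simp: pivots_def)

lemma pivots_bound:
  assumes "q \<in> pivots d n N"
  shows "q div N < d" "q mod N < N" "n (q div N) \<le> q mod N" "q < d * N"
proof -
  have q: "q < d * N" "n (q div N) \<le> q mod N" using assms by (auto simp: pivots_def)
  then have "N > 0" by (cases N) auto
  then show "q div N < d" "q mod N < N" "n (q div N) \<le> q mod N" "q < d * N"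
    using q by (auto simp: less_mult_imp_div_less)
qed

lemma block_less: "i < d \<Longrightarrow> l < N \<Longrightarrow> i * N + l < d * (N::nat)"
proof -
  assume "i < d" "l < N"
  have "i * N + l < Suc i * N" using \<open>l < N\<close> by simp
  also have "\<dots> \<le> d * N" using \<open>i < d\<close> by (intro mult_le_mono1) simp
  finally show ?thesis .
qed

lemma block_in_pivots: "i < d \<Longrightarrow> l < N \<Longrightarrow> n i \<le> l \<Longrightarrow> i * N + l \<in> pivots d n N"
  using block_less by (simp add: pivots_def)

lemma card_pivots:
  assumes "\<And>i. i < d \<Longrightarrow> n i \<le> N"
  shows "card (pivots d n N) + (\<Sum>i<d. n i) = d * N"
proof -
  have "bij_betw (\<lambda>q. (q div N, q mod N)) (pivots d n N) (SIGMA i:{..<d}. {n i..<N})"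
  proof (rule bij_betw_byWitness[where f' = "\<lambda>(i, l). i * N + l"])
    show "(\<lambda>q. (q div N, q mod N)) ` pivots d n N \<subseteq> (SIGMA i:{..<d}. {n i..<N})"
      using pivots_bound by fastforce
    show "(\<lambda>(i, l). i * N + l) ` (SIGMA i:{..<d}. {n i..<N}) \<subseteq> pivots d n N"
      using block_in_pivots by auto
  qed auto
  then have "card (pivots d n N) = card (SIGMA i:{..<d}. {n i..<N})" by (rule bij_betw_same_card)
  also have "\<dots> = (\<Sum>i<d. N - n i)" by simp
  finally have "card (pivots d n N) + (\<Sum>i<d. n i) = (\<Sum>i<d. (N - n i) + n i)"
    by (simp add: sum.distrib)
  also have "\<dots> = (\<Sum>i<d. N)" using assms by (intro sum.cong) auto
  finally show ?thesis by simp
qed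

lemma trunc_nth: "i < d \<Longrightarrow> l < N \<Longrightarrow> trunc d N v (i * N + l) = fps_nth (v i) l"
  using block_less by (simp add: trunc_def)

lemma trunc_in_aff: "trunc d N v \<in> aff (d * N)"
  by (simp add: trunc_def aff_def)

lemma trunc_eq_zero_iff:
  "trunc d N v = (\<lambda>_. 0) \<longleftrightarrow> (\<forall>i<d. \<forall>l<N. fps_nth (v i) l = 0)"
proof
  assume "trunc d N v = (\<lambda>_. 0)"
  then show "\<forall>i<d. \<forall>l<N. fps_nth (v i) l = 0" using trunc_nth by metis
next
  assume r: "\<forall>i<d. \<forall>l<N. fps_nth (v i) l = 0"
  have "trunc d N v q = 0" for q
  proof (cases "q < d * N")
    case True
    then have "N > 0" by (cases N) auto
    then have "q div N < d" "q mod N < N" using True by (auto simp: less_mult_imp_div_less)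
    then show ?thesis using r True by (simp add: trunc_def)
  qed (simp add: trunc_def)
  then show "trunc d N v = (\<lambda>_. 0)" by blast
qed

lemma trunc_diff: "trunc d N (\<lambda>k. u k - v k) = (\<lambda>q. trunc d N u q - trunc d N v q)"
  by (auto simp: trunc_def)

lemma trunc_sum:
  "trunc d N (\<lambda>k. \<Sum>r\<in>I. fps_const (a r) * u r k) = (\<lambda>q. \<Sum>r\<in>I. a r * trunc d N (u r) q)"
  by (auto simp: trunc_def fps_sum_nth fun_eq_iff)

text \<open>The condition is that t^N L lies in \<open>Xi\<close>, rather than that the exponents
  sum to \<open>N\<close>: for a point of the Grassmannian the inclusion is known first, and the sum
  is deduced from the echelon form.\<close>

locale triangular_level = triangular +
  fixes N :: nat
  assumes diag_le: "i < d \<Longrightarrow> n i \<le> N"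
    and X_power_Xi: "v \<in> Lset d \<Longrightarrow> (\<lambda>k. fps_X ^ N * v k) \<in> Xi d M"
begin

text \<open>The kernel of truncation is t^N L, which \<open>Xi\<close> contains, so nothing is lost
  by truncating.\<close>

lemma preim_trunc_Xi: "preim d N (trunc d N ` Xi d M) = Xi d M"
proof (intro equalityI subsetI)
  fix v assume "v \<in> Xi d M"
  then show "v \<in> preim d N (trunc d N ` Xi d M)"
    using submod_subset[OF submod_Xi] by (auto simp: preim_def)
next
  fix v assume "v \<in> preim d N (trunc d N ` Xi d M)"
  then obtain w where w: "v \<in> Lset d" "w \<in> Xi d M" "trunc d N v = trunc d N w"
    by (auto simp: preim_def)
  define u where "u k = fps_shift N (v k - w k)" for k
  have "trunc d N (\<lambda>k. v k - w k) = (\<lambda>_. 0)" using w(3) by (simp add: trunc_diff)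
  then have z: "fps_nth (v i - w i) l = 0" if "i < d" "l < N" for i l
    using that unfolding trunc_eq_zero_iff by blast
  have wL: "w \<in> Lset d" using w(2) by (rule submod_subset[OF submod_Xi])
  have "v k - w k = fps_X ^ N * u k" for k
  proof (cases "k < d")
    case True
    then show ?thesis using z by (simp add: u_def fps_eq_iff fps_X_power_mult_nth)
  next
    case False
    then show ?thesis using w(1) wL by (simp add: u_def Lset_def)
  qed
  moreover have "u \<in> Lset d" using w(1) wL by (simp add: u_def Lset_def)
  ultimately have "(\<lambda>k. v k - w k) \<in> Xi d M" using X_power_Xi by simp
  from submod_add[OF submod_Xi this w(2)] show "v \<in> Xi d M" by simp
qed

lemma echelon_vec_in_Xi: "echelon_vec d n M N q \<in> Xi d M"
  unfolding echelon_vec_def by (rule diff_red_in_Xi) simp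

lemma echelon_vec_pivot:
  assumes "q \<in> pivots d n N" "q' \<in> pivots d n N"
  shows "trunc d N (echelon_vec d n M N q) q' = (if q = q' then 1 else 0)"
proof -
  note q' = pivots_bound[OF assms(2)]
  have "fps_nth (red n M d (monom_vec N q) (q' div N)) (q' mod N) = 0"
    using reduced_red q' by (auto simp: reduced_def)
  moreover have "q = q' \<longleftrightarrow> q div N = q' div N \<and> q mod N = q' mod N"
    by (metis div_mult_mod_eq)
  ultimately show ?thesis
    using q' by (auto simp: trunc_def echelon_vec_def monom_vec_def)
qed

lemma echelon_vec_low:
  assumes "q \<in> pivots d n N" "c < q"
  shows "trunc d N (echelon_vec d n M N q) c = 0"
proof -
  note q = pivots_bound[OF assms(1)]
  have le: "c div N \<le> q div N" using assms(2) by (simp add: div_le_mono)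
  have "red n M d (monom_vec N q) (c div N) = 0"
    by (rule red_leading[OF q(1) _ _ le]) (use q in \<open>auto simp: monom_vec_def\<close>)
  moreover have "c div N = q div N \<Longrightarrow> c mod N \<noteq> q mod N"
    using assms(2) by (metis div_mult_mod_eq less_irrefl)
  ultimately show ?thesis by (auto simp: trunc_def echelon_vec_def monom_vec_def)
qed

lemma rref_at_echelon:
  "rref_at (d * N) (card (pivots d n N)) (echelon d n M N) (\<lambda>r. sorted_list_of_set (pivots d n N) ! r)"
proof -
  define p where "p r = sorted_list_of_set (pivots d n N) ! r" for r
  have mono: "strict_mono_on {..<card (pivots d n N)} p"
    unfolding strict_mono_on_def p_def
    using sorted_wrt_nth_less[OF strict_sorted_list_of_set[of "pivots d n N"]] finite_pivots by auto
  have p: "p r \<in> pivots d n N" if "r < card (pivots d n N)" for r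
    using that nth_mem[of r "sorted_list_of_set (pivots d n N)"] finite_pivots
    unfolding p_def by simp
  have inj: "p r = p r' \<longleftrightarrow> r = r'" if "r < card (pivots d n N)" "r' < card (pivots d n N)" for r r'
    using strict_mono_on_imp_inj_on[OF mono] that by (auto simp: inj_on_def)
  have "rref_at (d * N) (card (pivots d n N)) (echelon d n M N) p"
    unfolding rref_at_def
    using mono p pivots_bound(4)[OF p] echelon_vec_pivot[OF p p] echelon_vec_low[OF p] inj trunc_in_aff
    by (auto simp: echelon_def p_def[symmetric] aff_def)
  then show ?thesis by (simp add: p_def [abs_def])
qed

lemma rowspace_echelon: "rowspace (card (pivots d n N)) (echelon d n M N) = trunc d N ` Xi d M"
proof -
  define K where "K = card (pivots d n N)"
  define p where "p r = sorted_list_of_set (pivots d n N) ! r" for r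
  have R: "rref_at (d * N) K (echelon d n M N) p"
    using rref_at_echelon by (simp add: K_def p_def [abs_def])
  have row: "echelon d n M N r = trunc d N (echelon_vec d n M N (p r))" if "r < K" for r
    using that by (simp add: echelon_def K_def p_def)
  have comb: "(\<lambda>c. \<Sum>r<K. a r * echelon d n M N r c) =
      trunc d N (\<lambda>k. \<Sum>r<K. fps_const (a r) * echelon_vec d n M N (p r) k)" for a
    by (simp add: trunc_sum row)
  have combXi: "(\<lambda>k. \<Sum>r<K. fps_const (a r) * echelon_vec d n M N (p r) k) \<in> Xi d M" for a
    by (intro submod_sum[OF submod_Xi] echelon_vec_in_Xi)
  have "rowspace K (echelon d n M N) \<subseteq> trunc d N ` Xi d M"
    using comb combXi by (auto simp: rowspace_def)
  moreover have "trunc d N v \<in> rowspace K (echelon d n M N)" if v: "v \<in> Xi d M" for v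
  proof -
    \<comment> \<open>The coefficients of a combination of echelon rows are its pivot entries, so
      this is the only candidate.\<close>
    define u where "u k = (\<Sum>r<K. fps_const (trunc d N v (p r)) * echelon_vec d n M N (p r) k)" for k
    define w where "w k = v k - u k" for k
    have tw: "trunc d N w = (\<lambda>q. trunc d N v q - trunc d N u q)"
      unfolding w_def [abs_def] by (rule trunc_diff)
    have u: "u \<in> Xi d M" unfolding u_def by (rule combXi)
    have w: "w \<in> Xi d M" unfolding w_def using v u by (rule submod_diff[OF submod_Xi])
    have tu: "trunc d N u = (\<lambda>c. \<Sum>r<K. trunc d N v (p r) * echelon d n M N r c)"
      unfolding u_def comb[symmetric] by simp
    have piv: "trunc d N w q = 0" if q: "q \<in> pivots d n N" for q
    proof -
      have "q \<in> set (sorted_list_of_set (pivots d n N))" using q finite_pivots by simp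
      then obtain s where s: "s < K" "q = p s"
        unfolding in_set_conv_nth K_def p_def by auto
      have "trunc d N u (p s) = (\<Sum>r<K. if r = s then trunc d N v (p s) else 0)"
        unfolding tu using R s(1) by (intro sum.cong) (auto simp: rref_at_def)
      then show ?thesis using s by (simp add: tw)
    qed
    \<comment> \<open>Dropping the terms of degree at least \<open>N\<close> changes
      \<open>w\<close> by an element of \<open>Xi\<close>. The result is reduced, since below
      \<open>N\<close> only the pivots could violate reducedness, and there \<open>w\<close>
      vanishes.\<close>
    define y where "y k = w k - fps_X ^ N * fps_shift N (w k)" for k
    have wL: "w \<in> Lset d" using w by (rule submod_subset[OF submod_Xi])
    have "y = (\<lambda>_. 0)"
    proof (rule Xi_reduced_zero)
      have "(\<lambda>k. fps_shift N (w k)) \<in> Lset d" using wL by (simp add: Lset_def)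
      then show "y \<in> Xi d M" unfolding y_def using w X_power_Xi by (intro submod_diff[OF submod_Xi])
      have "fps_nth (y i) l = 0" if "i < d" "n i \<le> l" for i l
      proof (cases "l < N")
        case True
        then have "fps_nth (w i) l = 0"
          using piv[OF block_in_pivots[where n = n, OF that(1) True that(2)]] trunc_nth[OF that(1) True] by simp
        then show ?thesis using True by (simp add: y_def fps_X_power_mult_nth)
      next
        case False
        then show ?thesis by (simp add: y_def fps_X_power_mult_nth)
      qed
      then show "reduced d n y" by (simp add: reduced_def)
    qed
    then have "w k = fps_X ^ N * fps_shift N (w k)" for k by (simp add: y_def fun_eq_iff)
    then have "fps_nth (w i) l = 0" if "l < N" for i l
      using that by (metis fps_X_power_mult_nth)
    then have "trunc d N w = (\<lambda>_. 0)" by (simp add: trunc_eq_zero_iff)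
    then have "trunc d N v = trunc d N u"
      by (simp add: tw fun_eq_iff)
    then show ?thesis unfolding tu rowspace_def by (intro CollectI exI conjI TrueI)
  qed
  ultimately show ?thesis unfolding K_def by blast
qed

end

section \<open>Hermite normal form\<close>

lemma hermite_form:
  assumes U: "is_submod d U" and X_power: "\<And>v. v \<in> Lset d \<Longrightarrow> (\<lambda>k. fps_X ^ N * v k) \<in> U"
  obtains n x where "x \<in> Tset d n" "\<And>i. i < d \<Longrightarrow> n i \<le> N" "\<And>i. d \<le> i \<Longrightarrow> n i = 0"
    "Xi d (tmat d n x) = U"
proof -
  \<comment> \<open>The least \<open>l\<close> with \<open>P i l\<close> is the least order of
    coordinate \<open>i\<close> among elements of \<open>U\<close> that start there; t^N x_i shows
    that it is at most \<open>N\<close>.\<close>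
  define P where "P i l \<longleftrightarrow> (\<exists>v\<in>U. (\<forall>k<i. v k = 0) \<and> fps_nth (v i) l \<noteq> 0)" for i l
  define n where "n i = (if i < d then LEAST l. P i l else 0)" for i
  have PN: "P i N" if "i < d" for i
  proof -
    have "(\<lambda>k. fps_X ^ N * unit_vec i k) \<in> U"
      using that by (intro X_power) (simp add: unit_vec_def Lset_def)
    then show ?thesis unfolding P_def by (rule bexI[rotated]) (simp add: unit_vec_def)
  qed
  have n_le: "n i \<le> N" if "i < d" for i
    using Least_le[of "P i", OF PN[OF that]] that by (simp add: n_def)
  have nP: "P i (n i)" if "i < d" for i
    using LeastI[of "P i", OF PN[OF that]] that by (simp add: n_def)
  have n_min: "\<not> P i l" if "i < d" "l < n i" for i l
    using not_less_Least[of l "P i"] that by (simp add: n_def)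
  have "\<exists>b\<in>U. (\<forall>k<i. b k = 0) \<and> b i = fps_X ^ n i" if i: "i < d" for i
  proof -
    obtain v where v: "v \<in> U" "\<forall>k<i. v k = 0" "fps_nth (v i) (n i) \<noteq> 0"
      using nP[OF i] unfolding P_def by blast
    \<comment> \<open>By minimality v_i is t^(n i) times \<open>g\<close>, and \<open>g\<close> is a
      unit because its constant term is nonzero. Its inverse turns the diagonal entry into a pure
      power of t.\<close>
    define g where "g = fps_shift (n i) (v i)"
    have "v i = fps_X ^ n i * g"
    proof (rule fps_ext)
      fix l
      show "fps_nth (v i) l = fps_nth (fps_X ^ n i * g) l"
        using n_min[OF i, of l] v(1,2) by (auto simp: g_def fps_X_power_mult_nth P_def)
    qed
    moreover have "inverse g * g = 1" using v(3) by (intro inverse_mult_eq_1) (simp add: g_def)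
    ultimately have "inverse g * v i = fps_X ^ n i"
      by (metis mult.assoc mult.commute mult.right_neutral)
    then show ?thesis using v submod_smul[OF U v(1), of "inverse g"]
      by (intro bexI[of _ "\<lambda>k. inverse g * v k"]) auto
  qed
  then obtain b where b: "\<And>i. i < d \<Longrightarrow> b i \<in> U" "\<And>i k. i < d \<Longrightarrow> k < i \<Longrightarrow> b i k = 0"
    "\<And>i. i < d \<Longrightarrow> b i i = fps_X ^ n i"
    by metis
  define B where "B i = (if i < d then b i else (\<lambda>_. 0))" for i
  interpret B: triangular d n B
    using b submod_subset[OF U b(1)] by unfold_locales (auto simp: B_def Lset_def)
  have XiU: "Xi d M \<subseteq> U" if "\<And>i. i < d \<Longrightarrow> M i \<in> U" for M
    using that submod_sum[OF U, of "{..<d}" M] by (auto simp: Xi_def)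
  define e :: "nat \<Rightarrow> vec" where "e i = (\<lambda>k. if k = i then fps_X ^ n i else 0)" for i
  \<comment> \<open>The rows of \<open>B\<close> have the right diagonal but unbounded entries
    behind it. Subtracting from t^(n i) x_i its remainder modulo \<open>B\<close> keeps the diagonal
    and makes the later entries reduced.\<close>
  define H where "H i k = e i k - red n B d (e i) k" for i k
  have HU: "H i \<in> U" for i
    using XiU[of B] b(1) B.diff_red_in_Xi[of d "e i"] by (auto simp: H_def [abs_def] B_def)
  have H_low: "H i k = e i k" if "i < d" "k \<le> i" for i k
    unfolding H_def by (subst B.red_leading[OF that(1) _ _ that(2)]) (auto simp: e_def)
  define S where "S = (\<Sum>r<d. n r)"
  define x where "x q = (if q \<in> tvalid d n
    then fps_nth (H (q div S div d) (q div S mod d)) (q mod S) else 0)" for q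
  have row: "tmat d n x i = H i" if i: "i < d" for i
  proof
    fix k
    show "tmat d n x i k = H i k"
    proof (cases "k < d")
      case k: True
      show ?thesis
      proof (cases "k \<le> i")
        case True
        then show ?thesis using H_low[OF i True] i k by (auto simp: tmat_def e_def)
      next
        case False
        then have ik: "i < k" by simp
        show ?thesis
        proof (rule fps_ext)
          fix l
          show "fps_nth (tmat d n x i k) l = fps_nth (H i k) l"
          proof (cases "l < n k")
            case True
            have "x (tcoord d n i k l) = fps_nth (H i k) l"
              using tcoord_decode[where n = n and i = i and j = k, OF k less_sum_diag[where n = n, OF k True]]
                True ik k by (auto simp: x_def S_def tvalid_def)
            then show ?thesis using tmat_upper[OF ik k] True by simp
          next
            case False
            then show ?thesis
              using tmat_upper[OF ik k] ik k B.reduced_red[of "e i"]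
              by (auto simp: H_def e_def reduced_def)
          qed
        qed
      qed
    next
      case False
      then show ?thesis using submod_subset[OF U HU] by (auto simp: Lset_def tmat_def)
    qed
  qed
  interpret T: triangular d n "tmat d n x" by (rule triangular_tmat)
  have sub: "Xi d (tmat d n x) \<subseteq> U" using row HU by (intro XiU) simp
  have "v \<in> Xi d (tmat d n x)" if v: "v \<in> U" for v
  proof -
    define r where "r = red n (tmat d n x) d v"
    have "(\<lambda>k. v k - r k) \<in> U" using sub T.diff_red_in_Xi[of d v] by (auto simp: r_def)
    from submod_diff[OF U v this] have rU: "r \<in> U" by simp
    \<comment> \<open>The first nonzero coordinate of \<open>r\<close> would have order below
      \<open>n k\<close> by reducedness, against the minimality of \<open>n k\<close>, as
      \<open>r\<close> lies in \<open>U\<close>.\<close>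
    have "r k = 0" for k
    proof (induction k rule: less_induct)
      case (less k)
      show ?case
      proof (cases "k < d")
        case True
        have "fps_nth (r k) l = 0" for l
        proof (cases "l < n k")
          case l: True
          then show ?thesis using n_min[OF True l] rU less by (auto simp: P_def)
        next
          case False
          then show ?thesis using T.reduced_red[of v] True by (simp add: r_def reduced_def)
        qed
        then show ?thesis by (simp add: fps_eq_iff)
      next
        case False
        then show ?thesis using submod_subset[OF U rU] by (simp add: Lset_def)
      qed
    qed
    then show ?thesis unfolding T.in_Xi_iff r_def by blast
  qed
  then have "Xi d (tmat d n x) = U" using sub by blast
  moreover have "x \<in> Tset d n" by (simp add: Tset_def x_def)
  ultimately show ?thesis using that n_le by (simp add: n_def)
qed

section \<open>Stratification of the space of submodules\<close>

definition echelon_map :: "nat \<Rightarrow> nat \<Rightarrow> (nat \<Rightarrow> nat) \<Rightarrow> (nat \<Rightarrow> complex) \<Rightarrow> (nat \<Rightarrow> complex)" where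
  "echelon_map d N n x = flat (d * N) (d * N - N) (echelon d n (tmat d n x) N)"

lemma echelon_map_in_aff: "echelon_map d N n x \<in> aff ((d * N - N) * (d * N))"
  by (simp add: echelon_map_def flat_def aff_def)

lemma poly_map_echelon_map: "poly_map (echelon_map d N n)"
proof -
  have v: "(\<lambda>x. echelon_vec d n (tmat d n x) N q k) \<in> pser" for q k
    unfolding echelon_vec_def by (intro pser_diff pser_const pser_red pser_tmat)
  have t: "(\<lambda>x. trunc d N (echelon_vec d n (tmat d n x) N q) s) \<in> polyfun" for q s
    by (cases "s < d * N") (simp_all add: trunc_def pser_nth v polyfun.pconst)
  have e: "(\<lambda>x. echelon d n (tmat d n x) N r s) \<in> polyfun" for r s
    by (cases "r < card (pivots d n N)") (simp_all add: echelon_def t polyfun.pconst)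
  show ?thesis
    unfolding echelon_map_def [abs_def] flat_def by (rule poly_map_cases) (rule e)
qed

lemma comps_sum: "n \<in> comps d N \<Longrightarrow> (\<Sum>i<d. n i) = N"
  by (simp add: comps_def)

lemma comps_le: "n \<in> comps d N \<Longrightarrow> i < d \<Longrightarrow> n i \<le> N"
  using member_le_sum[of i "{..<d}" n] by (simp add: comps_def)

lemma finite_comps: "finite (comps d N)"
proof (rule finite_subset)
  show "comps d N \<subseteq> {f. \<forall>i. (i \<in> {..<d} \<longrightarrow> f i \<in> {..N}) \<and> (i \<notin> {..<d} \<longrightarrow> f i = 0)}"
    using comps_le by (auto simp: comps_def)
  show "finite {f::nat \<Rightarrow> nat. \<forall>i. (i \<in> {..<d} \<longrightarrow> f i \<in> {..N}) \<and> (i \<notin> {..<d} \<longrightarrow> f i = 0)}"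
    by (rule finite_set_of_finite_funs) simp_all
qed

lemma triangular_level_tmat:
  assumes "n \<in> comps d N"
  shows "triangular_level d n (tmat d n x) N"
proof -
  interpret triangular d n "tmat d n x" by (rule triangular_tmat)
  show ?thesis
  proof
    show "n i \<le> N" if "i < d" for i using comps_le[OF assms that] .
    show "(\<lambda>k. fps_X ^ N * v k) \<in> Xi d (tmat d n x)" if "v \<in> Lset d" for v
      using X_power_smul_in_Xi[OF that, of 0] comps_sum[OF assms] by (simp add: atLeast0LessThan)
  qed
qed

lemma card_pivots_comps:
  assumes "n \<in> comps d N"
  shows "card (pivots d n N) = d * N - N" "N \<le> d * N"
proof -
  have "card (pivots d n N) + N = d * N"
    using card_pivots[of d n N, OF comps_le[OF assms]] unfolding comps_sum[OF assms] .
  then show "card (pivots d n N) = d * N - N" "N \<le> d * N" by linarith+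
qed

lemma rref_echelon_comps:
  assumes "n \<in> comps d N"
  shows "rref (d * N) (d * N - N) (echelon d n (tmat d n x) N)"
  using triangular_level.rref_at_echelon[OF triangular_level_tmat[OF assms], of x]
  unfolding rref_iff card_pivots_comps(1)[OF assms] by blast

lemma rowspace_echelon_comps:
  assumes "n \<in> comps d N"
  shows "rowspace (d * N - N) (echelon d n (tmat d n x) N) = trunc d N ` Xi d (tmat d n x)"
  using triangular_level.rowspace_echelon[OF triangular_level_tmat[OF assms], of x]
  unfolding card_pivots_comps(1)[OF assms] .

text \<open>The matrix determines the truncated submodule, its preimage is the submodule itself, and
  this determines the exponents and then the normal form.\<close>

lemma echelon_map_eq_imp_eq:
  assumes n: "n \<in> comps d N" and m: "m \<in> comps d N" and x: "x \<in> Tset d n" and y: "y \<in> Tset d m"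
    and eq: "echelon_map d N n x = echelon_map d N m y"
  shows "n = m" "x = y"
proof -
  have "echelon d n (tmat d n x) N = echelon d m (tmat d m y) N"
    using eq unfolding echelon_map_def by (rule flat_inj[OF rref_echelon_comps[OF n] rref_echelon_comps[OF m]])
  then have "trunc d N ` Xi d (tmat d n x) = trunc d N ` Xi d (tmat d m y)"
    unfolding rowspace_echelon_comps[OF n, symmetric] rowspace_echelon_comps[OF m, symmetric]
    by (rule arg_cong)
  moreover have "preim d N (trunc d N ` Xi d (tmat d n x)) = Xi d (tmat d n x)"
    by (rule triangular_level.preim_trunc_Xi[OF triangular_level_tmat[OF n]])
  moreover have "preim d N (trunc d N ` Xi d (tmat d m y)) = Xi d (tmat d m y)"
    by (rule triangular_level.preim_trunc_Xi[OF triangular_level_tmat[OF m]])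
  ultimately have Xi: "Xi d (tmat d n x) = Xi d (tmat d m y)" by metis
  have "n i = m i" for i
  proof (cases "i < d")
    case True
    then show ?thesis by (rule Xi_eq_imp_diag_eq[OF triangular_tmat triangular_tmat Xi])
  next
    case False
    then show ?thesis using n m by (simp add: comps_def)
  qed
  then show "n = m" by blast
  then show "x = y" using Xi_tmat_inj[OF x] y Xi by simp
qed

text \<open>Row \<open>i\<close> of the normal form is already t^(n i) x_i minus a reduced vector,
  so uniqueness of remainders identifies it.\<close>

lemma echelon_vec_diag:
  assumes "i < d" "n i < N"
  shows "echelon_vec d n (tmat d n x) N (i * N + n i) = tmat d n x i"
proof -
  interpret triangular d n "tmat d n x" by (rule triangular_tmat)
  have "reduced d n (\<lambda>k. monom_vec N (i * N + n i) k - tmat d n x i k)"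
    using assms by (auto simp: reduced_def monom_vec_def tmat_def)
  from red_unique[OF row_in_Xi[OF assms(1)] this] show ?thesis
    by (simp add: echelon_vec_def)
qed

text \<open>The entries of the triangular matrix reappear in its echelon form, namely in the rows
  whose pivots are the diagonal positions; reading them off inverts \<^const>\<open>echelon_map\<close>.\<close>

lemma echelon_map_left_inverse:
  assumes n: "n \<in> comps d N"
  obtains g where "poly_map g" "\<And>y. g y \<in> aff (d * d * N)"
    "\<And>x. x \<in> Tset d n \<Longrightarrow> g (echelon_map d N n x) = x"
proof -
  define K where "K = d * N - N"
  define p where "p r = sorted_list_of_set (pivots d n N) ! r" for r
  define idx where "idx i = (SOME r. r < K \<and> p r = i * N + n i)" for i
  define g :: "(nat \<Rightarrow> complex) \<Rightarrow> nat \<Rightarrow> complex" where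
    "g y q = (if q \<in> tvalid d n
       then y (idx (q div N div d) * (d * N) + ((q div N mod d) * N + q mod N)) else 0)" for y q
  have "poly_map g"
    unfolding g_def [abs_def] by (rule poly_map_cases) (rule polyfun.pvar)
  moreover have "g y \<in> aff (d * d * N)" for y
  proof -
    have "tvalid d n \<subseteq> {..<d * d * N}"
      using tcoord_less[of _ d _ _ n] less_sum_diag[of _ d _ n] comps_sum[OF n]
      by (fastforce simp: tvalid_def)
    then show ?thesis by (auto simp: aff_def g_def)
  qed
  moreover have "g (echelon_map d N n x) = x" if x: "x \<in> Tset d n" for x
  proof
    fix q
    show "g (echelon_map d N n x) q = x q"
    proof (cases "q \<in> tvalid d n")
      case True
      then obtain i j l where q: "q = tcoord d n i j l" "i < j" "j < d" "l < n j"
        by (auto simp: tvalid_def)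
      have i: "i < d" using q by simp
      have "l < (\<Sum>r<d. n r)" using less_sum_diag[where n = n, OF q(3,4)] .
      from tcoord_decode[OF q(3) this, of i]
      have dec: "q div N div d = i" "q div N mod d = j" "q mod N = l"
        unfolding comps_sum[OF n] q(1) by auto
      have lN: "l < N" using comps_le[OF n q(3)] q(4) by simp
      \<comment> \<open>The entry a_ij has coordinates only if n_j is positive. As n_i + n_j is at
        most \<open>N\<close>, this leaves n_i < N, so the diagonal position is a column of block
        \<open>i\<close>.\<close>
      have "(\<Sum>r\<in>{i, j}. n r) \<le> (\<Sum>r<d. n r)"
        using i q by (intro sum_mono2) auto
      then have niN: "n i < N" using q comps_sum[OF n] by simp
      have "i * N + n i \<in> set (sorted_list_of_set (pivots d n N))"
        using block_in_pivots[where n = n, OF i niN] finite_pivots by simp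
      then have "\<exists>r. r < K \<and> p r = i * N + n i"
        unfolding in_set_conv_nth by (auto simp: K_def p_def card_pivots_comps[OF n])
      from someI_ex[OF this] have r: "idx i < K" "p (idx i) = i * N + n i"
        unfolding idx_def by auto
      have jl: "j * N + l < d * N" by (rule block_less[OF q(3) lN])
      have div: "(idx i * (d * N) + (j * N + l)) div (d * N) = idx i"
      proof -
        have "d * N \<noteq> 0" using jl by linarith
        then show ?thesis using jl by (subst div_mult_self3) auto
      qed
      have "g (echelon_map d N n x) q = echelon_map d N n x (idx i * (d * N) + (j * N + l))"
        using True by (simp add: g_def dec)
      also have "\<dots> = echelon d n (tmat d n x) N (idx i) (j * N + l)"
        using block_less[OF r(1) jl] jl div by (simp add: echelon_map_def flat_def K_def)
      also have "\<dots> = trunc d N (tmat d n x i) (j * N + l)"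
        using r echelon_vec_diag[where n = n, OF i niN, of x]
        by (simp add: echelon_def card_pivots_comps[OF n] K_def p_def)
      also have "\<dots> = x q"
        using trunc_nth[OF q(3) lN] tmat_upper[OF q(2,3)] q by simp
      finally show ?thesis .
    next
      case False
      then show ?thesis using x by (simp add: g_def Tset_def)
    qed
  qed
  ultimately show ?thesis by (rule that)
qed

section \<open>From points of the Grassmannian back to normal forms\<close>

lemma trunc_image_preim:
  assumes "W \<subseteq> aff (d * N)"
  shows "trunc d N ` preim d N W = W"
proof (intro equalityI subsetI)
  fix w assume w: "w \<in> W"
  define v :: vec where "v i = (if i < d then Abs_fps (\<lambda>l. w (i * N + l)) else 0)" for i
  have "trunc d N v q = w q" for q
  proof (cases "q < d * N")
    case True
    then have "q div N < d" by (simp add: less_mult_imp_div_less)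
    then show ?thesis using True by (simp add: trunc_def v_def)
  next
    case False
    then show ?thesis using assms w by (auto simp: trunc_def aff_def)
  qed
  then have "trunc d N v = w" by blast
  moreover have "v \<in> Lset d" by (simp add: v_def Lset_def)
  ultimately show "w \<in> trunc d N ` preim d N W"
    using w by (intro image_eqI[of _ _ v]) (auto simp: preim_def)
qed (auto simp: preim_def)

lemma Bset_stratification:
  "Bset d c kind N = (\<Union>n\<in>comps d N. echelon_map d N n ` Fset d c kind n)"
proof (intro equalityI subsetI)
  fix y assume "y \<in> (\<Union>n\<in>comps d N. echelon_map d N n ` Fset d c kind n)"
  then obtain n x where n: "n \<in> comps d N" and x: "x \<in> Fset d c kind n" "y = echelon_map d N n x"
    by blast
  have "good d c kind (preim d N (trunc d N ` Xi d (tmat d n x)))"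
    using x(1) triangular_level.preim_trunc_Xi[OF triangular_level_tmat[OF n], of x]
    by (simp add: Fset_def)
  then show "y \<in> Bset d c kind N"
    unfolding Bset_def grass_pts_def x(2) echelon_map_def
    using card_pivots_comps(2)[OF n] rref_echelon_comps[OF n, of x]
    by (intro CollectI exI[of _ "echelon d n (tmat d n x) N"] conjI refl)
      (simp_all add: rowspace_echelon_comps[OF n])
next
  fix y assume "y \<in> Bset d c kind N"
  then obtain R where y: "y = flat (d * N) (d * N - N) R" and N: "N \<le> d * N"
    and R: "rref (d * N) (d * N - N) R" and W: "good d c kind (preim d N (rowspace (d * N - N) R))"
    unfolding Bset_def grass_pts_def by blast
  define W where "W = rowspace (d * N - N) R"
  define U where "U = preim d N W"
  have U: "is_submod d U" using W by (simp add: good_def U_def W_def)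
  have zero: "(\<lambda>_. 0) \<in> W"
    unfolding W_def rowspace_def by (intro CollectI exI[of _ "\<lambda>_. 0"]) simp
  have "(\<lambda>k. fps_X ^ N * v k) \<in> U" if "v \<in> Lset d" for v
  proof -
    have "trunc d N (\<lambda>k. fps_X ^ N * v k) = (\<lambda>_. 0)"
      unfolding trunc_eq_zero_iff by (simp add: fps_X_power_mult_nth)
    then show ?thesis using zero that by (simp add: U_def preim_def Lset_def)
  qed
  then obtain n x where x: "x \<in> Tset d n" "\<And>i. i < d \<Longrightarrow> n i \<le> N" "\<And>i. d \<le> i \<Longrightarrow> n i = 0"
    "Xi d (tmat d n x) = U" and XU: "\<And>v. v \<in> Lset d \<Longrightarrow> (\<lambda>k. fps_X ^ N * v k) \<in> U"
    using hermite_form[OF U, of N] by metis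
  interpret triangular d n "tmat d n x" by (rule triangular_tmat)
  interpret triangular_level d n "tmat d n x" N
    using x XU by unfold_locales auto
  have "W \<subseteq> aff (d * N)"
    using R by (auto simp: W_def rowspace_def aff_def rref_iff rref_at_def)
  then have "trunc d N ` U = W" unfolding U_def by (rule trunc_image_preim)
  then have "rowspace (d * N - N) R = rowspace (card (pivots d n N)) (echelon d n (tmat d n x) N)"
    using rowspace_echelon x(4) by (simp add: W_def)
  moreover have "rref (d * N) (card (pivots d n N)) (echelon d n (tmat d n x) N)"
    using rref_at_echelon unfolding rref_iff by blast
  ultimately have eq: "d * N - N = card (pivots d n N)" "R = echelon d n (tmat d n x) N"
    using rref_unique[OF R] by auto
  \<comment> \<open>Uniqueness of the echelon form has fixed the number of rows; counting pivots
    turns it into the sum of the exponents. Here \<open>N\<close> being at most \<open>d * N\<close>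
    matters, since the subtraction is truncated.\<close>
  have "card (pivots d n N) + (\<Sum>i<d. n i) = d * N" using x(2) by (rule card_pivots)
  then have "(\<Sum>i<d. n i) = N" using eq(1) N by linarith
  then have "n \<in> comps d N" using x(3) by (simp add: comps_def)
  moreover have "x \<in> Fset d c kind n"
    using x W by (simp add: Fset_def U_def W_def)
  moreover have "y = echelon_map d N n x" by (simp add: y eq(2) echelon_map_def)
  ultimately show "y \<in> (\<Union>n\<in>comps d N. echelon_map d N n ` Fset d c kind n)" by blast
qed

lemma euler_char_Bset:
  assumes chi: "euler_char chi"
  shows "chi (Bset d c kind N) = (\<Sum>n\<in>comps d N. chi (Fset d c kind n))"
proof -
  have F: "Fset d c kind n \<in> constr (d * d * N)" if "n \<in> comps d N" for n
    using Fset_constr[of d c kind n] comps_sum[OF that] by simp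
  have T: "Fset d c kind n \<subseteq> Tset d n" for n by (auto simp: Fset_def)
  have im: "echelon_map d N n ` Fset d c kind n \<in> constr ((d * N - N) * (d * N))"
    if n: "n \<in> comps d N" for n
  proof -
    obtain g where "poly_map g" "\<And>y. g y \<in> aff (d * d * N)"
      "\<And>x. x \<in> Tset d n \<Longrightarrow> g (echelon_map d N n x) = x"
      using echelon_map_left_inverse[OF n] by blast
    then show ?thesis
      using T echelon_map_in_aff
      by (intro constr_image[OF F[OF n] poly_map_echelon_map, of g]) auto
  qed
  have "chi (Bset d c kind N) = (\<Sum>n\<in>comps d N. chi (echelon_map d N n ` Fset d c kind n))"
    unfolding Bset_stratification
  proof (rule euler_char_UN[OF chi finite_comps im])
    fix n m assume "n \<in> comps d N" "m \<in> comps d N" "n \<noteq> m"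
    then show "echelon_map d N n ` Fset d c kind n \<inter> echelon_map d N m ` Fset d c kind m = {}"
      using echelon_map_eq_imp_eq(1) T by blast
  qed
  also have "\<dots> = (\<Sum>n\<in>comps d N. chi (Fset d c kind n))"
  proof (rule sum.cong[OF refl])
    fix n assume n: "n \<in> comps d N"
    have "inj_on (echelon_map d N n) (Fset d c kind n)"
      using echelon_map_eq_imp_eq(2)[OF n n] T by (auto simp: inj_on_def)
    then show "chi (echelon_map d N n ` Fset d c kind n) = chi (Fset d c kind n)"
      by (rule euler_char_inj_image[OF chi im[OF n] F[OF n] poly_map_echelon_map])
  qed
  finally show ?thesis .
qed

section \<open>The torus of a removable pair\<close>

lemma good_image:
  assumes aut: "lie_aut d c \<phi>" and U: "good d c kind U"
  shows "good d c kind (\<phi> ` U)"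
proof -
  have bij: "bij_betw \<phi> (Lset d) (Lset d)"
    and add: "\<And>u v. u \<in> Lset d \<Longrightarrow> v \<in> Lset d \<Longrightarrow> \<phi> (vadd u v) = vadd (\<phi> u) (\<phi> v)"
    and sm: "\<And>a u. u \<in> Lset d \<Longrightarrow> \<phi> (smul a u) = smul a (\<phi> u)"
    and br: "\<And>u v. u \<in> Lset d \<Longrightarrow> v \<in> Lset d \<Longrightarrow> \<phi> (lbr d c u v) = lbr d c (\<phi> u) (\<phi> v)"
    using aut unfolding lie_aut_def by blast+
  have im: "\<phi> ` Lset d = Lset d" using bij by (rule bij_betw_imp_surj_on)
  have sub: "is_submod d U" using U by (simp add: good_def)
  have UL: "u \<in> Lset d" if "u \<in> U" for u using submod_subset[OF sub that] .
  have smU: "smul a u \<in> U" and addU: "vadd u v \<in> U" if "u \<in> U" "v \<in> U" for a u v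
    using sub that by (auto simp: is_submod_def)
  have "is_submod d (\<phi> ` U)"
    unfolding is_submod_def
  proof (intro conjI ballI allI)
    show "\<phi> ` U \<subseteq> Lset d" using UL im by blast
    have z: "(\<lambda>_. 0) \<in> U" using sub by (simp add: is_submod_def)
    have "\<phi> (\<lambda>_. 0) = (\<lambda>_. 0)" using sm[OF UL[OF z], of 0] by (simp add: smul_def)
    then show "(\<lambda>_. 0) \<in> \<phi> ` U" using z by (metis image_eqI)
  next
    fix u v assume "u \<in> \<phi> ` U" "v \<in> \<phi> ` U"
    then obtain u' v' where "u' \<in> U" "v' \<in> U" "u = \<phi> u'" "v = \<phi> v'" by blast
    then show "vadd u v \<in> \<phi> ` U" using add addU UL by (metis image_eqI)
  next
    fix a u assume "u \<in> \<phi> ` U"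
    then obtain u' where "u' \<in> U" "u = \<phi> u'" by blast
    then show "smul a u \<in> \<phi> ` U" using sm smU UL by (metis image_eqI)
  qed
  moreover have "lbr d c u v \<in> \<phi> ` U" if "kind = Subalg" "u \<in> \<phi> ` U" "v \<in> \<phi> ` U" for u v
  proof -
    obtain u' v' where "u' \<in> U" "v' \<in> U" "u = \<phi> u'" "v = \<phi> v'" using \<open>u \<in> _\<close> \<open>v \<in> _\<close> by blast
    moreover from this have "lbr d c u' v' \<in> U" using U \<open>kind = _\<close> by (simp add: good_def)
    ultimately show ?thesis using br UL by (metis image_eqI)
  qed
  moreover have "lbr d c u v \<in> \<phi> ` U" if "kind = Ideal" "u \<in> Lset d" "v \<in> \<phi> ` U" for u v
  proof -
    \<comment> \<open>For ideals the left factor ranges over all of L, and surjectivity of the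
      automorphism pulls it back.\<close>
    obtain u' v' where "u' \<in> Lset d" "v' \<in> U" "u = \<phi> u'" "v = \<phi> v'"
      using \<open>u \<in> _\<close> \<open>v \<in> _\<close> im by blast
    moreover from this have "lbr d c u' v' \<in> U" using U \<open>kind = _\<close> by (simp add: good_def)
    ultimately show ?thesis using br UL by (metis image_eqI)
  qed
  ultimately show ?thesis by (cases kind) (auto simp: good_def)
qed

text \<open>The automorphism multiplies column j by z^(l_j), which spoils the diagonal; multiplying
  row i by z^(-l_i) restores it without changing the row span. Thus a_ij acquires the weight l_j -
  l_i, nonzero exactly when l_i and l_j differ.\<close>

definition tcoord_weight :: "nat \<Rightarrow> (nat \<Rightarrow> nat) \<Rightarrow> (nat \<Rightarrow> int) \<Rightarrow> nat \<Rightarrow> int" where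
  "tcoord_weight d n l q = l (q div (\<Sum>r<d. n r) mod d) - l (q div (\<Sum>r<d. n r) div d)"

lemma tcoord_weight_tcoord:
  assumes "j < d" "m < n j"
  shows "tcoord_weight d n l (tcoord d n i j m) = l j - l i"
  using tcoord_decode[where n = n, OF assms(1) less_sum_diag[where n = n, OF assms], of i]
  by (simp add: tcoord_weight_def)

lemma tmat_scale:
  assumes "z \<noteq> 0"
  shows "tmat d n (scale (tcoord_weight d n l) z x) i k =
    fps_const (z powi (l k - l i)) * tmat d n x i k"
proof (cases "i < k \<and> k < d")
  case True
  have "fps_nth (tmat d n (scale (tcoord_weight d n l) z x) i k) m =
      fps_nth (fps_const (z powi (l k - l i)) * tmat d n x i k) m" for m
    using True tcoord_weight_tcoord[where n = n, of k d m l i]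
    by (simp add: tmat_upper scale_apply)
  then show ?thesis by (rule fps_ext)
next
  case False
  then show ?thesis by (auto simp: tmat_def)
qed

text \<open>Here M' is the conjugate D^(-1) M D with D diagonal with entries z^(l_r). The left
  factor only rescales the rows; the right factor is the automorphism.\<close>

lemma Xi_scaled:
  assumes z: "z \<noteq> 0" and M': "\<And>i k. i < d \<Longrightarrow> M' i k = fps_const (z powi (l k - l i)) * M i k"
  shows "Xi d M' = (\<lambda>u r. fps_const (z powi l r) * u r) ` Xi d M"
proof -
  have comb: "(\<Sum>i<d. a i * M' i k) =
      fps_const (z powi l k) * (\<Sum>i<d. (a i * fps_const (z powi - l i)) * M i k)" for a k
  proof -
    have "a i * M' i k = fps_const (z powi l k) * ((a i * fps_const (z powi - l i)) * M i k)"
      if "i < d" for i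
    proof -
      have "fps_const (z powi (l k - l i)) = fps_const (z powi l k) * fps_const (z powi - l i)"
        using z power_int_add[of z "l k" "- l i"] by simp
      then show ?thesis using M'[OF that] by (simp add: mult_ac)
    qed
    then show ?thesis unfolding sum_distrib_left by (intro sum.cong) auto
  qed
  show ?thesis
  proof (intro equalityI subsetI)
    fix v assume "v \<in> Xi d M'"
    then obtain a where a: "v = (\<lambda>k. \<Sum>i<d. a i * M' i k)" by (auto simp: Xi_def)
    have "(\<lambda>k. \<Sum>i<d. (a i * fps_const (z powi - l i)) * M i k) \<in> Xi d M"
      unfolding Xi_def by (intro CollectI exI[of _ "\<lambda>i. a i * fps_const (z powi - l i)"]) simp
    then show "v \<in> (\<lambda>u r. fps_const (z powi l r) * u r) ` Xi d M"
      unfolding a comb by (rule image_eqI[rotated]) simp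
  next
    fix v assume "v \<in> (\<lambda>u r. fps_const (z powi l r) * u r) ` Xi d M"
    then obtain b where b: "v = (\<lambda>k. fps_const (z powi l k) * (\<Sum>i<d. b i * M i k))"
      by (auto simp: Xi_def)
    have "fps_const (z powi l i) * fps_const (z powi - l i) = (1 :: complex fps)" for i
      using z power_int_add[of z "l i" "- l i"] by simp
    then have cancel: "(b i * fps_const (z powi l i)) * fps_const (z powi - l i) = b i" for i
      by (metis mult.assoc mult.right_neutral)
    have "v = (\<lambda>k. \<Sum>i<d. (b i * fps_const (z powi l i)) * M' i k)"
      unfolding b comb cancel ..
    then show "v \<in> Xi d M'" unfolding Xi_def by (intro CollectI exI conjI TrueI)
  qed
qed

lemma Fset_scale:
  assumes aut: "lie_aut d c (\<lambda>u r. fps_const (z powi l r) * u r)" and z: "z \<noteq> 0"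
    and x: "x \<in> Fset d c kind n"
  shows "scale (tcoord_weight d n l) z x \<in> Fset d c kind n"
  using good_image[OF aut, of kind "Xi d (tmat d n x)"] x
    Xi_scaled[OF z, of d "tmat d n (scale (tcoord_weight d n l) z x)" l "tmat d n x", OF tmat_scale[OF z]]
  by (simp add: Fset_def Tset_def scale_apply)

lemma euler_char_Eset:
  assumes chi: "euler_char chi" and C: "\<forall>p\<in>C. removable d c p"
  shows "chi (Eset d n C \<inter> Fset d c kind n) = chi (Fset d c kind n)"
proof -
  define Q where "Q = {tcoord d n i j m | i j m. (i, j) \<in> C \<and> m < n j}"
  have ij: "i < j" "j < d" if "(i, j) \<in> C" for i j
    using C that by (auto simp: removable_def)
  \<comment> \<open>Removability bounds both indices by \<open>d\<close>, so only finitely many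
    coordinates have to be cleared.\<close>
  have "Q \<subseteq> {..<d * d * (\<Sum>r<d. n r)}"
  proof
    fix q assume "q \<in> Q"
    then obtain i j m where q: "q = tcoord d n i j m" "(i, j) \<in> C" "m < n j" by (auto simp: Q_def)
    have "i < d" "j < d" using ij[OF q(2)] by auto
    then show "q \<in> {..<d * d * (\<Sum>r<d. n r)}"
      using tcoord_less[where n = n] less_sum_diag[where n = n] q by simp
  qed
  then have "finite Q" by (rule finite_subset) simp
  have "tmat d n x i j = 0 \<longleftrightarrow> (\<forall>m<n j. x (tcoord d n i j m) = 0)" if "(i, j) \<in> C" for i j x
    using tmat_upper[OF ij[OF that], of n x] by (auto simp: fps_eq_iff)
  then have "Eset d n C \<inter> Fset d c kind n = {x \<in> Fset d c kind n. \<forall>q\<in>Q. x q = 0}"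
    by (fastforce simp: Eset_def Fset_def Q_def)
  moreover have "chi {x \<in> Fset d c kind n. \<forall>q\<in>Q. x q = 0} = chi (Fset d c kind n)"
  proof (rule euler_char_torus_coordinates[OF chi Fset_constr \<open>finite Q\<close>])
    fix q assume "q \<in> Q"
    then obtain i j m where q: "q = tcoord d n i j m" "(i, j) \<in> C" "m < n j" by (auto simp: Q_def)
    then obtain l where l: "l i \<noteq> l j"
      "\<And>z. z \<noteq> 0 \<Longrightarrow> lie_aut d c (\<lambda>u r. fps_const (z powi l r) * u r)"
      using C by (fastforce simp: removable_def)
    have "tcoord_weight d n l q \<noteq> 0"
      using tcoord_weight_tcoord[where n = n, OF ij(2)[OF q(2)] q(3)] l(1) q(1) by simp
    then show "\<exists>w. w q \<noteq> 0 \<and> (\<forall>z x. z \<noteq> 0 \<longrightarrow> x \<in> Fset d c kind n \<longrightarrow> scale w z x \<in> Fset d c kind n)"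
      using Fset_scale[OF l(2)] by blast
  qed
  ultimately show ?thesis by simp
qed

theorem theorem3p2:
  fixes d :: nat
    and c :: "nat \<Rightarrow> nat \<Rightarrow> nat \<Rightarrow> complex fps"
    and chi :: "(nat \<Rightarrow> complex) set \<Rightarrow> int"
    and kind :: subkind
    and C :: "(nat \<times> nat) set"
  assumes "lie_algebra d c"
    and "euler_char chi"
    and "\<forall>p\<in>C. removable d c p"
  shows "zeta chi d c kind =
    Abs_fps (\<lambda>N. \<Sum>n\<in>comps d N. chi (Eset d n C \<inter> Fset d c kind n))"
  unfolding zeta_def using assms(2,3) by (simp add: euler_char_Bset euler_char_Eset)

end
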